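(* Let $k \geq 2$ and $t \geq 5$ be integers and let $G$ be a graph with $|G| \geq (2t-1)k$. If $\sigma_t(G) \geq 2kt - t + 1$, then $G$ contains $k$ pairwise vertex-disjoint cycles.
   Context: All graphs are finite, undirected, and simple (no loops, no multiple edges). $|G| = |V(G)|$ is the order of $G$, and $d_G(x)$ is the degree of $x$ in $G$. For a positive integer $t$, $\sigma_t(G) = \min\{\sum_{x \in X} d_G(x) : X \text{ is an independent set of } G \text{ with } |X| = t\}$, with the usual convention that $\sigma_t(G) = +\infty$ if $G$ has no independent set of size $t$. *)

theory Defs
  imports "Graph_Theory.Graph_Theory" "HOL-Library.Extended_Nat"
begin

text \<open>
  Finite simple undirected graphs are the library's \<^locale>\<open>graph\<close>s: finite symmetric digraphs
  without loops and parallel arcs. Every undirected edge is represented by its two opposite arcs,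
  so the out-degree of a vertex is its undirected degree.
\<close>

definition independent_set :: "('a, 'b) pre_digraph \<Rightarrow> 'a set \<Rightarrow> bool" where
  "independent_set G X \<longleftrightarrow> X \<subseteq> verts G \<and> (\<forall>x\<in>X. \<forall>y\<in>X. \<not> x \<rightarrow>\<^bsub>G\<^esub> y)"

text \<open>
  In \<^typ>\<open>enat\<close> the infimum of a nonempty set is its minimum, and the infimum of the empty
  set is infinity.
\<close>

definition sigma :: "nat \<Rightarrow> ('a, 'b) pre_digraph \<Rightarrow> enat" where
  "sigma t G = (INF X\<in>{X. independent_set G X \<and> card X = t}. enat (\<Sum>x\<in>X. out_degree G x))"

text \<open>
  A cycle of a symmetric digraph may run back and forth along one edge; such a cycle has length 2,
  and excluding it leaves exactly the undirected cycles.
\<close>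

definition undirected_cycle :: "('a, 'b) pre_digraph \<Rightarrow> 'b list \<Rightarrow> bool" where
  "undirected_cycle G p \<longleftrightarrow> pre_digraph.cycle G p \<and> length p \<ge> 3"

definition cycle_verts :: "('a, 'b) pre_digraph \<Rightarrow> 'b list \<Rightarrow> 'a set" where
  "cycle_verts G p = tail G ` set p"

end

theory Submission
  imports Defs
begin

text \<open>
  Induct on k. Among all packings of k - 1 disjoint cycles take one with the fewest vertices and,
  among those, with the most edges in the remaining graph H. If there are no k disjoint cycles, H is
  a forest. A vertex of H has at most one neighbour on a cycle of length at least 5 and at most two
  on a 4-cycle; if it has three on a triangle, then, since swapping it for a vertex of the triangle
  cannot add edges to H, only few edges join the triangle to H. Hence t independent vertices of H
  of degree at most 2 in H send at most 2t edges to every cycle, so H has fewer than t independent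
  vertices of degree at most 1, thus few branches; counting also rules out cycles longer than 4,
  so that H has at least 4t - 6 vertices. All but 2t - 2 vertices of H have degree at least 2k; those
  among them with degree at most 2 in H then have exactly two neighbours in H and on every cycle,
  and on a given cycle all of them share the same two neighbours u and v. As there are no two disjoint
  cycles through u and v in H with u and v added, the Helly property of subtrees bounds the number
  of these vertices, and H would have at most 3t - 2 vertices.
\<close>

text \<open>Averaging over one independent set cannot finish the proof: t independent vertices of H
  with two neighbours in H and two on each of the k - 1 cycles have degree sum 2kt, well above (2k -
  1)t + 1. The averaged count only limits the vertices of degree at most 1 in H. For degree 2 the
  condition is used differently: the vertices of total degree below 2k span a forest without t
  independent vertices, so there are at most 2t - 2 of them, and any other vertex of degree at most
  2 in H must reach 2k with no slack. This rigidity takes the place of the missing surplus.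

  Two constants make t >= 5 natural. A triangle completely joined to a vertex of degree at most 2 in
  H receives at most 9 edges from H, and 9 < 2t. The final comparison is 3t - 2 < 4t - 6, where 4t -
  6 is (2t - 1)k - 4(k - 1) at k = 2. One tight configuration, t = 5 and k = 2 with a single
  4-cycle, escapes the general count and is excluded separately.\<close>

locale fin_graph =
  fixes V :: "'a set" and E :: "'a \<Rightarrow> 'a \<Rightarrow> bool"
  assumes finV: "finite V" and sym: "E x y \<Longrightarrow> E y x" and irr: "\<not> E x x" and inV: "E x y \<Longrightarrow> x \<in> V"
begin

definition dg :: "'a \<Rightarrow> 'a set \<Rightarrow> nat" where
  "dg x S = card {y \<in> S. E x y}"

text \<open>Pairs are ordered, so \<open>esum S S\<close> is twice the number of edges inside S.
  This is the origin of the factors 2 in the forest bounds.\<close>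

definition esum :: "'a set \<Rightarrow> 'a set \<Rightarrow> nat" where
  "esum S T = (\<Sum>x\<in>S. dg x T)"

text \<open>
  A set of vertices contains a cycle if and only if it contains a nonempty set inducing a graph of
  minimum degree at least 2. Such cores stand for cycles throughout; inclusion-minimal ones
  are the vertex sets of induced cycles.
\<close>

definition core :: "'a set \<Rightarrow> bool" where
  "core K \<longleftrightarrow> K \<subseteq> V \<and> K \<noteq> {} \<and> (\<forall>x\<in>K. 2 \<le> dg x K)"

definition acyc :: "'a set \<Rightarrow> bool" where
  "acyc S \<longleftrightarrow> S \<subseteq> V \<and> (\<forall>K\<subseteq>S. \<not> core K)"

definition indep :: "'a set \<Rightarrow> bool" where
  "indep X \<longleftrightarrow> (\<forall>x\<in>X. \<forall>y\<in>X. \<not> E x y)"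

text \<open>Connectivity by cuts instead of paths: the inductions only ask for an edge leaving a
  proper part. The empty set is connected in this sense, hence the nonemptiness condition in
  \<open>conn_helly\<close>.\<close>

definition conn :: "'a set \<Rightarrow> bool" where
  "conn S \<longleftrightarrow> (\<forall>A\<subseteq>S. A \<noteq> {} \<and> A \<noteq> S \<longrightarrow> (\<exists>a\<in>A. \<exists>b\<in>S - A. E a b))"

subsection \<open>Degrees into a set\<close>

lemma finite_sub: "S \<subseteq> V \<Longrightarrow> finite S"
  using finV finite_subset by blast

lemma dg_sum: "finite S \<Longrightarrow> dg x S = (\<Sum>y\<in>S. if E x y then 1 else 0)"
  unfolding dg_def by (simp add: sum.If_cases Int_def)

lemma dg_empty [simp]: "dg x {} = 0"
  by (simp add: dg_def)

lemma dg_mono: "finite T \<Longrightarrow> S \<subseteq> T \<Longrightarrow> dg x S \<le> dg x T"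
  unfolding dg_def by (rule card_mono) auto

lemma dg_le_card: "finite S \<Longrightarrow> dg x S \<le> card S"
  unfolding dg_def by (rule card_mono) auto

lemma dg_Un: "finite S \<Longrightarrow> finite T \<Longrightarrow> S \<inter> T = {} \<Longrightarrow> dg x (S \<union> T) = dg x S + dg x T"
  by (simp add: dg_sum sum.union_disjoint)

lemma dg_insert: "finite S \<Longrightarrow> y \<notin> S \<Longrightarrow> dg x (insert y S) = (if E x y then 1 else 0) + dg x S"
  by (simp add: dg_sum)

lemma dg_remove: "finite S \<Longrightarrow> y \<in> S \<Longrightarrow> dg x S = (if E x y then 1 else 0) + dg x (S - {y})"
  using dg_insert[of "S - {y}" y x] by (simp add: insert_absorb)

lemma dg_self: "finite S \<Longrightarrow> dg x (S - {x}) = dg x S"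
  unfolding dg_def by (rule arg_cong[where f=card]) (use irr in auto)

lemma dg_UNION:
  assumes "finite \<F>" "\<And>C. C \<in> \<F> \<Longrightarrow> finite C" "\<And>C D. C \<in> \<F> \<Longrightarrow> D \<in> \<F> \<Longrightarrow> C \<noteq> D \<Longrightarrow> C \<inter> D = {}"
  shows "dg x (\<Union>\<F>) = (\<Sum>C\<in>\<F>. dg x C)"
proof -
  have "finite (\<Union>\<F>)" using assms by auto
  then have "dg x (\<Union>\<F>) = (\<Sum>C\<in>\<F>. \<Sum>y\<in>C. if E x y then 1 else 0)"
    using assms by (simp add: dg_sum sum.Union_disjoint)
  also have "\<dots> = (\<Sum>C\<in>\<F>. dg x C)"
    using assms(2) by (intro sum.cong refl) (simp add: dg_sum)
  finally show ?thesis .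
qed

lemma dg_pos_iff: "finite S \<Longrightarrow> 0 < dg x S \<longleftrightarrow> (\<exists>y\<in>S. E x y)"
  unfolding dg_def by (auto simp: card_gt_0_iff)

lemma dg_ge2I: "finite S \<Longrightarrow> y \<in> S \<Longrightarrow> z \<in> S \<Longrightarrow> y \<noteq> z \<Longrightarrow> E x y \<Longrightarrow> E x z \<Longrightarrow> 2 \<le> dg x S"
proof -
  assume a: "finite S" "y \<in> S" "z \<in> S" "y \<noteq> z" "E x y" "E x z"
  have "card {y,z} \<le> card {y \<in> S. E x y}"
    by (rule card_mono) (use a in auto)
  then show ?thesis unfolding dg_def using a by simp
qed

lemma dg_ge2E:
  assumes "2 \<le> dg x S"
  obtains y z where "y \<in> S" "z \<in> S" "y \<noteq> z" "E x y" "E x z"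
proof -
  from assms obtain T where "T \<subseteq> {y \<in> S. E x y}" "card T = 2"
    unfolding dg_def by (meson obtain_subset_with_card_n)
  then show ?thesis using that by (auto simp: card_2_iff)
qed

lemma dg_le1_unique:
  assumes "dg x S \<le> 1" "finite S" "y \<in> S" "z \<in> S" "E x y" "E x z" shows "y = z"
proof (rule ccontr)
  assume "y \<noteq> z"
  then have "2 \<le> dg x S" using assms by (intro dg_ge2I[of S y z])
  then show False using assms(1) by linarith
qed

lemma esum_empty [simp]: "esum {} T = 0"
  by (simp add: esum_def)

lemma esum_swap: "finite S \<Longrightarrow> finite T \<Longrightarrow> esum S T = esum T S"
proof -
  assume f: "finite S" "finite T"
  have *: "E x y \<longleftrightarrow> E y x" for x y using sym by blast
  have "esum S T = (\<Sum>x\<in>S. \<Sum>y\<in>T. if E x y then 1 else 0)"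
    using f by (simp add: esum_def dg_sum)
  also have "\<dots> = (\<Sum>y\<in>T. \<Sum>x\<in>S. if E x y then 1 else 0)" by (rule sum.swap)
  also have "\<dots> = (\<Sum>y\<in>T. \<Sum>x\<in>S. if E y x then 1 else 0)" by (subst *) (rule refl)
  also have "\<dots> = esum T S" using f by (simp add: esum_def dg_sum)
  finally show ?thesis .
qed

lemma esum_insert: "finite S \<Longrightarrow> x \<notin> S \<Longrightarrow> esum (insert x S) T = dg x T + esum S T"
  by (simp add: esum_def)

lemma esum_insert_le: "finite S \<Longrightarrow> esum (insert x S) T \<le> dg x T + esum S T"
  by (cases "x \<in> S") (simp_all add: insert_absorb esum_insert)

lemma esum_Un_left: "finite S \<Longrightarrow> finite S' \<Longrightarrow> S \<inter> S' = {} \<Longrightarrow> esum (S \<union> S') T = esum S T + esum S' T"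
  by (simp add: esum_def sum.union_disjoint)

lemma esum_Un_right: "finite T \<Longrightarrow> finite T' \<Longrightarrow> T \<inter> T' = {} \<Longrightarrow> esum S (T \<union> T') = esum S T + esum S T'"
  by (simp add: esum_def dg_Un sum.distrib)

lemma esum_mono: "finite S' \<Longrightarrow> finite T' \<Longrightarrow> S \<subseteq> S' \<Longrightarrow> T \<subseteq> T' \<Longrightarrow> esum S T \<le> esum S' T'"
  unfolding esum_def
  by (rule order_trans[OF sum_mono sum_mono2]) (auto intro: dg_mono)

lemma esum_insert_insert:
  assumes "finite S" "x \<notin> S"
  shows "esum (insert x S) (insert x S) = esum S S + 2 * dg x S"
proof -
  have "esum (insert x S) (insert x S) = dg x (insert x S) + esum S (insert x S)"
    using assms by (simp add: esum_insert)
  also have "dg x (insert x S) = dg x S" using assms by (simp add: dg_insert irr)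
  also have "esum S (insert x S) = esum (insert x S) S"
    using assms by (simp add: esum_swap)
  finally show ?thesis using assms by (simp add: esum_insert)
qed

lemma esum_remove:
  assumes "finite S" "x \<in> S"
  shows "esum S S = esum (S - {x}) (S - {x}) + 2 * dg x S"
  using esum_insert_insert[of "S - {x}" x] assms by (simp add: insert_absorb dg_self)

subsection \<open>Forests\<close>

lemma acyc_subset: "acyc S \<Longrightarrow> T \<subseteq> S \<Longrightarrow> acyc T"
  unfolding acyc_def by blast

lemma acyc_finite: "acyc S \<Longrightarrow> finite S"
  unfolding acyc_def using finite_sub by blast

lemma acyc_leaf:
  assumes "acyc S" "S \<noteq> {}"
  obtains x where "x \<in> S" "dg x S \<le> 1"
proof -
  have "\<not> core S" "S \<subseteq> V" using assms(1) unfolding acyc_def by auto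
  then obtain x where "x \<in> S" "\<not> 2 \<le> dg x S" using assms(2) unfolding core_def by blast
  then show ?thesis using that[of x] by linarith
qed

lemma acyc_induct [consumes 1, case_names empty insert]:
  assumes "acyc S" "P {}"
    and "\<And>x S. x \<notin> S \<Longrightarrow> acyc (insert x S) \<Longrightarrow> acyc S \<Longrightarrow> finite S \<Longrightarrow> dg x S \<le> 1 \<Longrightarrow> P S \<Longrightarrow> P (insert x S)"
  shows "P S"
proof -
  have "finite S" using assms(1) by (rule acyc_finite)
  then show ?thesis using assms(1)
  proof (induction S rule: finite_psubset_induct)
    case (psubset S)
    show ?case
    proof (cases "S = {}")
      case False
      then obtain x where x: "x \<in> S" "dg x S \<le> 1" using psubset.prems acyc_leaf by blast
      have "acyc (S - {x})" using psubset.prems acyc_subset by blast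
      moreover from this have "P (S - {x})" using psubset.IH x by blast
      ultimately have "P (insert x (S - {x}))"
        using x psubset by (intro assms(3)) (auto simp: insert_absorb dg_self)
      then show ?thesis using x by (simp add: insert_absorb)
    qed (use assms in simp)
  qed
qed

text \<open>Removing a leaf loses one vertex and at most one edge, and the last vertex left has no
  edge.\<close>

lemma acyc_edges:
  assumes "acyc S" "S \<noteq> {}" shows "esum S S + 2 \<le> 2 * card S"
proof -
  have "S \<noteq> {} \<longrightarrow> esum S S + 2 \<le> 2 * card S"
    using assms(1)
  proof (induction rule: acyc_induct)
    case (insert x S)
    then show ?case by (cases "S = {}") (auto simp: esum_insert_insert)
  qed auto
  with assms show ?thesis by blast
qed

lemma core_of_edges:
  assumes "S \<subseteq> V" "S \<noteq> {}" "2 * card S \<le> esum S S"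
  obtains K where "K \<subseteq> S" "core K"
proof -
  have "\<not> acyc S" using acyc_edges[of S] assms(2,3) by linarith
  then show ?thesis using that assms(1) unfolding acyc_def by blast
qed

section \<open>Independent sets in forests\<close>

lemma indep_subset: "indep X \<Longrightarrow> Y \<subseteq> X \<Longrightarrow> indep Y"
  unfolding indep_def by blast

lemma indep_insert: "indep A \<Longrightarrow> \<forall>y\<in>A. \<not> E x y \<Longrightarrow> indep (insert x A)"
  unfolding indep_def using sym irr by blast

text \<open>A leaf has at most one neighbour among the other vertices, so it can join the class that
  avoids this neighbour.\<close>

lemma acyc_bipartite:
  assumes "acyc S"
  obtains A where "A \<subseteq> S" "indep A" "indep (S - A)"
proof -
  have "\<exists>A\<subseteq>S. indep A \<and> indep (S - A)"
    using assms
  proof (induction rule: acyc_induct)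
    case (insert x S)
    then obtain A where A: "A \<subseteq> S" "indep A" "indep (S - A)" by blast
    show ?case
    proof (cases "\<exists>y\<in>A. E x y")
      case True
      then have "\<forall>y\<in>S - A. \<not> E x y" using dg_le1_unique[OF insert.hyps(5,4)] A(1) by blast
      then have "indep (insert x (S - A))" using A by (intro indep_insert) auto
      moreover have "insert x S - A = insert x (S - A)" using A insert by auto
      ultimately show ?thesis using A by (intro exI[of _ A]) auto
    next
      case False
      then have "indep (insert x A)" using A by (intro indep_insert) auto
      moreover have "insert x S - insert x A = S - A" using insert by auto
      ultimately show ?thesis using A by (intro exI[of _ "insert x A"]) auto
    qed
  qed (auto simp: indep_def)
  then show ?thesis using that by blast
qed

lemma acyc_indep_large:
  assumes "acyc S" obtains A where "A \<subseteq> S" "indep A" "card S \<le> 2 * card A"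
proof -
  obtain A where A: "A \<subseteq> S" "indep A" "indep (S - A)" using acyc_bipartite assms by blast
  have "finite S" using assms acyc_finite by blast
  then have "card S = card A + card (S - A)" using A by (metis card_Diff_subset card_mono finite_subset le_add_diff_inverse)
  then show ?thesis using that[of A] that[of "S - A"] A by (cases "card A \<ge> card (S - A)") auto
qed

lemma acyc_indep_card:
  assumes "acyc S" "2 * t - 1 \<le> card S"
  obtains X where "X \<subseteq> S" "indep X" "card X = t"
proof -
  obtain A where A: "A \<subseteq> S" "indep A" "card S \<le> 2 * card A" using acyc_indep_large assms by blast
  then have "t \<le> card A" using assms by linarith
  then obtain X where "X \<subseteq> A" "card X = t" by (meson obtain_subset_with_card_n)
  then show ?thesis using that[of X] A indep_subset[of A X] by auto
qed

text \<open>No edge has both ends in X, so the degree sum of X counts each edge at most once,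
  whereas \<open>esum S S\<close> counts it twice.\<close>

lemma indep_degree_sum:
  assumes "acyc S" "X \<subseteq> S" "indep X"
  shows "2 * esum X S \<le> esum S S"
proof -
  have f: "finite S" "finite X" "finite (S - X)" using assms acyc_finite finite_subset by auto
  have "esum X X = 0" using assms f unfolding esum_def indep_def by (auto simp: dg_def)
  have S: "S = X \<union> (S - X)" using assms by auto
  have "esum S S = esum X S + esum (S - X) S"
    using f by (subst S, subst esum_Un_left) auto
  moreover have "esum X S = esum X (S - X)"
    using f \<open>esum X X = 0\<close> by (subst S, subst esum_Un_right) auto
  moreover have "esum (S - X) X \<le> esum (S - X) S" using f assms by (intro esum_mono) auto
  moreover have "esum (S - X) X = esum X (S - X)" using f by (simp add: esum_swap)
  ultimately show ?thesis by linarith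
qed

text \<open>Discarding elements of value at least 3 keeps the average at most 2. This stops at t
  elements, or when all values are at most 2 and any t elements will do.\<close>

lemma subset_small_sum:
  fixes f :: "'b \<Rightarrow> nat"
  assumes "finite A" "t \<le> card A" "sum f A \<le> 2 * card A"
  shows "\<exists>X\<subseteq>A. card X = t \<and> sum f X \<le> 2 * t"
  using assms
proof (induction A rule: finite_psubset_induct)
  case (psubset A)
  show ?case
  proof (cases "\<forall>x\<in>A. f x \<le> 2")
    case True
    obtain X where X: "X \<subseteq> A" "card X = t" using psubset.prems by (meson obtain_subset_with_card_n)
    then have "sum f X \<le> (\<Sum>x\<in>X. 2)" using True by (intro sum_mono) auto
    then show ?thesis using X by auto
  next
    case False
    then obtain x where x: "x \<in> A" "f x \<ge> 3" by force
    have c: "card A = Suc (card (A - {x}))" using x psubset.hyps(1) by (metis card.remove)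
    have s: "sum f A = f x + sum f (A - {x})" using x psubset.hyps(1) by (metis sum.remove)
    show ?thesis
    proof (cases "t = card A")
      case True
      then show ?thesis using psubset.prems by auto
    next
      case False
      then have "t \<le> card (A - {x})" "sum f (A - {x}) \<le> 2 * card (A - {x})"
        using psubset.prems c s x by linarith+
      moreover have "A - {x} \<subset> A" using x by blast
      ultimately have "\<exists>X\<subseteq>A - {x}. card X = t \<and> sum f X \<le> 2 * t"
        using psubset.IH by blast
      then show ?thesis by blast
    qed
  qed
qed

lemma acyc_indep_small_degree:
  assumes "acyc S" "2 * t - 1 \<le> card S" "1 \<le> t"
  obtains X where "X \<subseteq> S" "indep X" "card X = t" "esum X S \<le> 2 * t"
proof -
  obtain A where A: "A \<subseteq> S" "indep A" "card S \<le> 2 * card A" using acyc_indep_large assms by blast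
  have "finite A" using A assms acyc_finite finite_subset by blast
  have "S \<noteq> {}" using assms by auto
  \<comment> \<open>The forest has fewer than \<open>card S\<close> edges and A has at least half of
    its vertices, so the average degree over A is at most 2.\<close>
  then have "2 * esum A S \<le> 2 * card S - 2"
    using indep_degree_sum[OF assms(1) A(1,2)] acyc_edges[OF assms(1)] by linarith
  then have "esum A S \<le> 2 * card A" using A by linarith
  moreover have "t \<le> card A" using A assms by linarith
  ultimately obtain X where "X \<subseteq> A" "card X = t" "esum X S \<le> 2 * t"
    using subset_small_sum[OF \<open>finite A\<close>, of t "\<lambda>x. dg x S"] unfolding esum_def by blast
  then show ?thesis using that[of X] A indep_subset[of A X] by auto
qed


subsection \<open>Connected sets in forests\<close>

lemma conn_edge:
  assumes "conn S" "A \<subseteq> S" "A \<noteq> {}" "A \<noteq> S"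
  obtains a b where "a \<in> A" "b \<in> S - A" "E a b"
  using assms unfolding conn_def by blast

lemma conn_neighbour:
  assumes "conn S" "x \<in> S" "S \<noteq> {x}"
  obtains y where "y \<in> S" "E x y"
  using conn_edge[of S "{x}"] assms by auto

lemma conn_singleton: "conn {x}"
  unfolding conn_def by auto

lemma conn_insert:
  assumes "conn S" "y \<in> S" "E x y"
  shows "conn (insert x S)"
  unfolding conn_def
proof (intro allI impI, elim conjE)
  fix A assume A: "A \<subseteq> insert x S" "A \<noteq> {}" "A \<noteq> insert x S"
  show "\<exists>a\<in>A. \<exists>b\<in>insert x S - A. E a b"
  proof (cases "A \<inter> S = {} \<or> S \<subseteq> A")
    case True
    then consider "A = {x}" "x \<notin> S" | "S \<subseteq> A" "x \<notin> A" using A by blast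
    then show ?thesis
    proof cases
      case 1 then show ?thesis using assms by auto
    next
      case 2 then show ?thesis using assms sym by blast
    qed
  next
    case False
    then show ?thesis using conn_edge[OF assms(1), of "A \<inter> S"] by blast
  qed
qed

text \<open>If A contains a neighbour of x, cut S at A together with x: the edge leaving this set
  cannot start at x, whose only neighbour is inside.\<close>

lemma conn_remove_leaf:
  assumes "conn S" "finite S" "dg x S \<le> 1"
  shows "conn (S - {x})"
  unfolding conn_def
proof (intro allI impI, elim conjE)
  fix A assume A: "A \<subseteq> S - {x}" "A \<noteq> {}" "A \<noteq> S - {x}"
  show "\<exists>a\<in>A. \<exists>b\<in>S - {x} - A. E a b"
  proof (cases "\<exists>y\<in>A. E x y")
    case True
    then obtain y where y: "y \<in> A" "E x y" by blast
    obtain a b where ab: "a \<in> insert x A" "b \<in> S - insert x A" "E a b"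
    proof (cases "x \<in> S")
      case True
      then show ?thesis using conn_edge[OF assms(1), of "insert x A"] A that by blast
    next
      case False
      then show ?thesis using conn_edge[OF assms(1), of "A"] A that by blast
    qed
    have "a \<noteq> x"
    proof
      assume "a = x"
      then have "b = y" using dg_le1_unique[OF assms(3,2), of b y] ab y A by blast
      then show False using ab y by blast
    qed
    then show ?thesis using ab by blast
  next
    case False
    obtain a b where ab: "a \<in> A" "b \<in> S - A" "E a b"
      using conn_edge[OF assms(1), of A] A by blast
    then have "b \<noteq> x" using False sym by blast
    then show ?thesis using ab by blast
  qed
qed

text \<open>If there were no core, leaves could be pared off S one by one without ever touching v or
  its neighbours.\<close>

lemma conn_core:
  assumes "conn S" "S \<subseteq> V" "v \<in> V" "v \<notin> S" "2 \<le> dg v S"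
  obtains K where "K \<subseteq> insert v S" "core K"
proof -
  have "\<not> acyc (insert v S)"
  proof
    assume "acyc (insert v S)"
    have "finite S" using assms(2) finite_sub by blast
    then show False using \<open>acyc (insert v S)\<close> assms
    proof (induction S rule: finite_psubset_induct)
      case (psubset S)
      obtain x where x: "x \<in> insert v S" "dg x (insert v S) \<le> 1"
        using psubset.prems(1) acyc_leaf[of "insert v S"] by blast
      have "dg v (insert v S) = dg v S" using psubset by (simp add: dg_insert irr)
      then have xS: "x \<in> S" using x psubset.prems by auto
      have xd: "dg x S \<le> 1" using x(2) dg_mono[of "insert v S" S x] psubset.hyps by fastforce
      obtain y where y: "y \<in> S" "E x y"
      proof -
        have "S \<noteq> {x}" using psubset.prems(6) dg_le_card[of "{x}" v] by auto
        then show ?thesis using conn_neighbour[OF psubset.prems(2) xS] that by blast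
      qed
      \<comment> \<open>The leaf x already has its neighbour y in S, so v cannot be another;
        deleting x leaves the degree of v into S unchanged.\<close>
      have "\<not> E v x"
      proof
        assume "E v x"
        then have "E x v" by (rule sym)
        then have "y = v"
          using dg_le1_unique[OF x(2), of y v] y psubset.hyps by simp
        then show False using y psubset.prems by blast
      qed
      then have "dg v (S - {x}) = dg v S" using dg_remove[of S x v] psubset.hyps xS by simp
      moreover have "conn (S - {x})" using conn_remove_leaf psubset.prems psubset.hyps xd by blast
      moreover have "acyc (insert v (S - {x}))" by (rule acyc_subset[OF psubset.prems(1)]) auto
      ultimately show False
        using psubset.IH[of "S - {x}"] psubset.prems xS by auto
    qed
  qed
  moreover have "insert v S \<subseteq> V" using assms by auto
  ultimately show ?thesis using that unfolding acyc_def by blast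
qed

text \<open>Delete a leaf x. If {x} is not itself in the family, all members stay nonempty and
  connected, and two members that met in x both contain its only neighbour, so they still
  meet.\<close>

lemma conn_helly:
  assumes "acyc H" "H \<noteq> {}"
    and "\<And>S. S \<in> \<F> \<Longrightarrow> S \<subseteq> H \<and> conn S \<and> S \<noteq> {}"
    and "\<And>S T. S \<in> \<F> \<Longrightarrow> T \<in> \<F> \<Longrightarrow> S \<inter> T \<noteq> {}"
  shows "\<exists>w\<in>H. \<forall>S\<in>\<F>. w \<in> S"
  using assms
proof (induction arbitrary: \<F> rule: acyc_induct)
  case (insert x H)
  show ?case
  proof (cases "{x} \<in> \<F>")
    case True
    then show ?thesis using insert.prems(3) by blast
  next
    case False
    show ?thesis
    proof (cases "H = {}")
      case True
      then have "\<F> = {}" using False insert.prems(2) by (metis equals0I subset_singletonD)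
      then show ?thesis by blast
    next
      case H: False
      have nb: "\<exists>y\<in>S. E x y" if "S \<in> \<F>" "x \<in> S" for S
        using conn_neighbour[of S x] insert.prems(2)[OF that(1)] that False by metis
      have "\<exists>w\<in>H. \<forall>S\<in>(\<lambda>S. S - {x}) ` \<F>. w \<in> S"
      proof (rule insert.IH[OF H])
        fix S assume "S \<in> (\<lambda>S. S - {x}) ` \<F>"
        then obtain S' where S': "S' \<in> \<F>" "S = S' - {x}" by blast
        have S'H: "S' \<subseteq> insert x H" "conn S'" "S' \<noteq> {}" using insert.prems(2)[OF S'(1)] by auto
        then have fin: "finite S'" using insert.hyps finite_subset by blast
        have "dg x S' \<le> 1"
        proof -
          have "dg x S' = dg x (S' - {x})" using fin by (simp add: dg_self)
          also have "\<dots> \<le> dg x H" using S'H insert.hyps by (intro dg_mono) auto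
          finally show ?thesis using insert.hyps by linarith
        qed
        then have "conn S" using conn_remove_leaf S'H fin S' by blast
        moreover have "S \<noteq> {}" using S' S'H False by (metis Diff_eq_empty_iff subset_singletonD)
        ultimately show "S \<subseteq> H \<and> conn S \<and> S \<noteq> {}" using S' S'H by blast
      next
        fix S T assume "S \<in> (\<lambda>S. S - {x}) ` \<F>" "T \<in> (\<lambda>S. S - {x}) ` \<F>"
        then obtain S' T' where ST: "S' \<in> \<F>" "S = S' - {x}" "T' \<in> \<F>" "T = T' - {x}" by blast
        obtain z where z: "z \<in> S'" "z \<in> T'" using insert.prems(3) ST by blast
        show "S \<inter> T \<noteq> {}"
        proof (cases "z = x")
          case False
          then show ?thesis using z ST by blast
        next
          case True
          obtain y where "y \<in> S'" "E x y" using nb[of S'] z ST True by auto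
          moreover obtain y' where "y' \<in> T'" "E x y'" using nb[of T'] z ST True by auto
          ultimately have y: "y \<in> S'" "E x y" "y' \<in> T'" "E x y'" by auto
          then have "y \<noteq> x" "y' \<noteq> x" using irr by auto
          moreover have "y \<in> insert x H" "y' \<in> insert x H" using insert.prems(2) ST y by blast+
          ultimately have "y = y'" using dg_le1_unique[OF insert.hyps(5,4), of y y'] y by blast
          then show ?thesis using y ST \<open>y \<noteq> x\<close> by blast
        qed
      qed
      then obtain w where "w \<in> H" "\<forall>S\<in>\<F>. w \<in> S - {x}" by auto
      then show ?thesis by auto
    qed
  qed
qed auto

section \<open>Marked vertices, leaves and branches of a forest\<close>

text \<open>A component holds at most one mark, and the number of components of a forest is its
  number of vertices minus its number of edges; the inequality is this fact doubled.\<close>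

lemma marks_bound:
  assumes "acyc F" "M \<subseteq> F" "\<And>S. S \<subseteq> F \<Longrightarrow> conn S \<Longrightarrow> card (M \<inter> S) \<le> 1"
  shows "2 * card M + esum F F \<le> 2 * card F"
  using assms
proof (induction arbitrary: M rule: acyc_induct)
  case (insert x F)
  have e: "esum (insert x F) (insert x F) = esum F F + 2 * dg x F"
    using insert.hyps by (simp add: esum_insert_insert)
  have finM: "finite M" using insert.prems insert.hyps finite_subset by blast
  show ?case
  proof (cases "x \<in> M")
    case False
    then have "2 * card M + esum F F \<le> 2 * card F" using insert.prems by (intro insert.IH) auto
    then show ?thesis using e insert.hyps by simp
  next
    case True
    then have cM: "card M = Suc (card (M - {x}))" using finM by (metis card.remove)
    show ?thesis
    proof (cases "dg x F = 0")
      case dg0: True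
      have "2 * card (M - {x}) + esum F F \<le> 2 * card F"
      proof (rule insert.IH)
        fix S assume "S \<subseteq> F" "conn S"
        then have "card (M \<inter> S) \<le> 1" using insert.prems(2)[of S] by blast
        moreover have "card ((M - {x}) \<inter> S) \<le> card (M \<inter> S)" using finM by (intro card_mono) auto
        ultimately show "card ((M - {x}) \<inter> S) \<le> 1" by linarith
      qed (use insert.prems in auto)
      then show ?thesis using e dg0 insert.hyps cM by simp
    next
      case False
      then obtain y where y: "y \<in> F" "E x y" using dg_pos_iff[of F x] insert.hyps by auto
      have yx: "y \<noteq> x" using y irr by blast
      have "conn {x, y}" using conn_insert[OF conn_singleton, of y y x] y by simp
      then have "card (M \<inter> {x, y}) \<le> 1" using insert.prems(2) y by simp
      then have yM: "y \<notin> M" using True yx by (auto simp: Int_insert_right)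
      \<comment> \<open>The mark moves from the leaf x to its neighbour y. A connected set through y
        stays connected when x is added, so it contains no further mark.\<close>
      define M' where "M' = insert y (M - {x})"
      have "card M' = card M" using cM yM finM unfolding M'_def by simp
      have "2 * card M' + esum F F \<le> 2 * card F"
      proof (rule insert.IH)
        show "M' \<subseteq> F" using insert.prems(1) y unfolding M'_def by auto
        fix S assume S: "S \<subseteq> F" "conn S"
        have xS: "x \<notin> S" using S insert.hyps by blast
        show "card (M' \<inter> S) \<le> 1"
        proof (cases "y \<in> S")
          case False
          then have "M' \<inter> S = M \<inter> S" using xS unfolding M'_def by blast
          then show ?thesis using insert.prems(2)[of S] S by auto
        next
          case yS: True
          have "conn (insert x S)" using conn_insert S yS y by blast
          then have "card (M \<inter> insert x S) \<le> 1" using insert.prems(2) S by blast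
          moreover have "M \<inter> insert x S = insert x (M \<inter> S)" using True by blast
          ultimately have "M \<inter> S = {}" using xS finM by simp
          then have "M' \<inter> S = {y}" using yS xS unfolding M'_def by blast
          then show ?thesis by simp
        qed
      qed
      moreover have "dg x F = 1" using False insert.hyps by linarith
      ultimately show ?thesis using e \<open>card M' = card M\<close> insert.hyps by simp
    qed
  qed
qed simp


text \<open>\<open>H0\<close> drops the isolated vertices and the isolated edges, since the two ends
  of an isolated edge are leaves that are not independent. The leaves left are independent, so there
  are fewer than t of them; the rest is the handshake count.\<close>

lemma branch_excess:
  assumes "acyc H" and few: "\<And>X. X \<subseteq> H \<Longrightarrow> indep X \<Longrightarrow> (\<forall>x\<in>X. dg x H \<le> 1) \<Longrightarrow> card X < t"
  obtains H0 where "H0 \<subseteq> H" "{x\<in>H. 2 \<le> dg x H} \<subseteq> H0" "\<forall>x\<in>H0. dg x H0 = dg x H"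
    "2 * card H0 + (\<Sum>x\<in>H0. dg x H - 2) < esum H0 H0 + t"
proof -
  define H0 where "H0 = {x\<in>H. 2 \<le> dg x H \<or> (\<exists>y\<in>H. E x y \<and> 2 \<le> dg y H)}"
  have fin: "finite H" "finite H0" using assms(1) acyc_finite unfolding H0_def by auto
  have "H0 \<subseteq> H" unfolding H0_def by auto
  have closed: "y \<in> H0" if x: "x \<in> H0" and y: "y \<in> H" "E x y" for x y
  proof (cases "2 \<le> dg x H")
    case True
    then show ?thesis using x y sym[OF y(2)] unfolding H0_def by blast
  next
    case False
    then obtain z where z: "z \<in> H" "E x z" "2 \<le> dg z H" using x unfolding H0_def by blast
    have "dg x H \<le> 1" using False by linarith
    then have "y = z" using dg_le1_unique fin(1) y z by blast
    then show ?thesis using z unfolding H0_def by blast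
  qed
  have dgH0: "dg x H0 = dg x H" if "x \<in> H0" for x
  proof -
    have "{y \<in> H0. E x y} = {y \<in> H. E x y}" using closed[OF that] \<open>H0 \<subseteq> H\<close> by blast
    then show ?thesis unfolding dg_def by simp
  qed
  define N where "N = {x\<in>H0. dg x H \<le> 1}"
  have "indep N"
    unfolding indep_def
  proof (intro ballI notI)
    fix x y assume xy: "x \<in> N" "y \<in> N" "E x y"
    then obtain z where z: "z \<in> H" "E x z" "2 \<le> dg z H" unfolding N_def H0_def by auto
    have "y = z" using dg_le1_unique[of x H y z] fin xy z unfolding N_def H0_def by blast
    then show False using xy z unfolding N_def by auto
  qed
  then have N: "card N < t" using few[of N] unfolding N_def H0_def by auto
  have "1 \<le> dg x H" if "x \<in> H0" for x
  proof -
    have "0 < dg x H \<or> 2 \<le> dg x H" using that dg_pos_iff[OF fin(1), of x] unfolding H0_def by blast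
    then show ?thesis by linarith
  qed
  \<comment> \<open>The subtraction is truncated: at degree 1 the excess is 0 instead of -1, which
    the extra 1 for a leaf corrects.\<close>
  then have "2 + (dg x H - 2) = dg x H + (if dg x H \<le> 1 then 1 else 0)" if "x \<in> H0" for x
    using that by fastforce
  then have "(\<Sum>x\<in>H0. 2 + (dg x H - 2)) = (\<Sum>x\<in>H0. dg x H + (if dg x H \<le> 1 then 1 else 0))"
    by (intro sum.cong) auto
  moreover have "(\<Sum>x\<in>H0. if dg x H \<le> 1 then 1 else 0) = card N"
    using fin unfolding N_def by (simp add: sum.If_cases Int_def)
  moreover have "(\<Sum>x\<in>H0. dg x H) = esum H0 H0" unfolding esum_def using dgH0 by simp
  ultimately have "2 * card H0 + (\<Sum>x\<in>H0. dg x H - 2) = esum H0 H0 + card N"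
    by (simp add: sum.distrib del: add_2_eq_Suc)
  then show ?thesis using that[of H0] N dgH0 \<open>H0 \<subseteq> H\<close> unfolding H0_def by auto
qed

text \<open>Every branch vertex adds at least 1 to the excess; the second bound keeps the full
  contribution \<open>dg w H - 2\<close> of one chosen branch vertex w.\<close>

lemma card_branch_le:
  assumes "finite H0" "{x\<in>H. 2 \<le> dg x H} \<subseteq> H0" "H0 \<subseteq> H"
  shows "card {x\<in>H. 3 \<le> dg x H} \<le> (\<Sum>x\<in>H0. dg x H - 2)"
    and "w \<in> H0 \<Longrightarrow> 3 \<le> dg w H \<Longrightarrow> card {x\<in>H. 3 \<le> dg x H} + dg w H \<le> (\<Sum>x\<in>H0. dg x H - 2) + 3"
proof -
  let ?W = "{x\<in>H. 3 \<le> dg x H}"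
  have W: "?W \<subseteq> H0" using assms(2) by fastforce
  then have fW: "finite ?W" using assms finite_subset by blast
  have le: "(\<Sum>x\<in>?W. dg x H - 2) \<le> (\<Sum>x\<in>H0. dg x H - 2)"
    using W assms by (intro sum_mono2) auto
  have c: "card S \<le> (\<Sum>x\<in>S. dg x H - 2)" if "S \<subseteq> ?W" for S
  proof -
    have "(\<Sum>x\<in>S. 1) \<le> (\<Sum>x\<in>S. dg x H - 2)" using that by (intro sum_mono) force
    then show ?thesis by simp
  qed
  show "card ?W \<le> (\<Sum>x\<in>H0. dg x H - 2)" using le c[OF subset_refl] by linarith
  assume w: "w \<in> H0" "3 \<le> dg w H"
  then have wW: "w \<in> ?W" using assms by auto
  have "(\<Sum>x\<in>?W. dg x H - 2) = (dg w H - 2) + (\<Sum>x\<in>?W - {w}. dg x H - 2)"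
    using fW wW by (rule sum.remove)
  moreover have "card ?W = Suc (card (?W - {w}))" using fW wW by (rule card.remove)
  ultimately show "card ?W + dg w H \<le> (\<Sum>x\<in>H0. dg x H - 2) + 3"
    using le c[of "?W - {w}"] w by auto
qed

lemma branch_bound:
  assumes "acyc H" "3 \<le> t" "\<And>X. X \<subseteq> H \<Longrightarrow> indep X \<Longrightarrow> (\<forall>x\<in>X. dg x H \<le> 1) \<Longrightarrow> card X < t"
  shows "card {x\<in>H. 3 \<le> dg x H} + 3 \<le> t"
proof -
  obtain H0 where H0: "H0 \<subseteq> H" "{x\<in>H. 2 \<le> dg x H} \<subseteq> H0" "\<forall>x\<in>H0. dg x H0 = dg x H"
    "2 * card H0 + (\<Sum>x\<in>H0. dg x H - 2) < esum H0 H0 + t"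
    by (rule branch_excess[OF assms(1,3)])
  have f: "finite H0" using H0 assms acyc_finite finite_subset by blast
  show ?thesis
  proof (cases "H0 = {}")
    case True
    then have "{x\<in>H. 3 \<le> dg x H} = {}" using H0(2) by fastforce
    then have "card {x\<in>H. 3 \<le> dg x H} = 0" by (simp only: card.empty)
    then show ?thesis using assms(2) by linarith
  next
    case False
    then have "esum H0 H0 + 2 \<le> 2 * card H0" using acyc_edges acyc_subset H0 assms by blast
    then show ?thesis using H0(4) card_branch_le(1)[OF f H0(2,1)] by linarith
  qed
qed

text \<open>By the Helly property of subtrees all connected sets with two marked vertices pass through
  one vertex w, so that every component of the forest without w has at most one marked vertex;
  and w can only have many branches if the forest has many leaves.\<close>

lemma marks_and_branches:
  assumes "acyc H" "M \<subseteq> H" "\<And>x. x \<in> M \<Longrightarrow> dg x H = 2" "3 \<le> t"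
    and few: "\<And>X. X \<subseteq> H \<Longrightarrow> indep X \<Longrightarrow> (\<forall>x\<in>X. dg x H \<le> 1) \<Longrightarrow> card X < t"
    and meet: "\<And>S T. S \<subseteq> H \<Longrightarrow> T \<subseteq> H \<Longrightarrow> conn S \<Longrightarrow> conn T \<Longrightarrow>
      2 \<le> card (M \<inter> S) \<Longrightarrow> 2 \<le> card (M \<inter> T) \<Longrightarrow> S \<inter> T \<noteq> {}"
  shows "card M + card {x\<in>H. 3 \<le> dg x H} \<le> t"
proof -
  obtain H0 where H0: "H0 \<subseteq> H" "{x\<in>H. 2 \<le> dg x H} \<subseteq> H0" "\<forall>x\<in>H0. dg x H0 = dg x H"
    "2 * card H0 + (\<Sum>x\<in>H0. dg x H - 2) < esum H0 H0 + t"
    by (rule branch_excess[OF assms(1) few])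
  have f: "finite H0" using H0(1) assms acyc_finite finite_subset by blast
  have MH0: "M \<subseteq> H0" using H0(2) assms(2,3) by force
  have finM: "finite M" using MH0 f finite_subset by blast
  show ?thesis
  proof (cases "H0 = {}")
    case True
    then show ?thesis using MH0 branch_bound[OF assms(1,4) few] by simp
  next
    case False
    have ac: "acyc H0" using acyc_subset[OF assms(1) H0(1)] .
    have e: "esum H0 H0 + 2 \<le> 2 * card H0" using acyc_edges ac False by blast
    have "\<exists>w\<in>H0. \<forall>S\<in>{S. S \<subseteq> H0 \<and> conn S \<and> 2 \<le> card (M \<inter> S)}. w \<in> S"
      using H0(1) by (intro conn_helly[OF ac False] meet) auto
    then obtain w where w: "w \<in> H0" "\<And>S. S \<subseteq> H0 \<Longrightarrow> conn S \<Longrightarrow> 2 \<le> card (M \<inter> S) \<Longrightarrow> w \<in> S"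
      by blast
    have "2 * card (M - {w}) + esum (H0 - {w}) (H0 - {w}) \<le> 2 * card (H0 - {w})"
    proof (rule marks_bound)
      show "acyc (H0 - {w})" using acyc_subset[OF ac] by blast
      show "M - {w} \<subseteq> H0 - {w}" using MH0 by blast
      fix S assume S: "S \<subseteq> H0 - {w}" "conn S"
      then have "\<not> 2 \<le> card (M \<inter> S)" using w(2)[of S] by blast
      moreover have "card ((M - {w}) \<inter> S) \<le> card (M \<inter> S)" using finM by (intro card_mono) auto
      ultimately show "card ((M - {w}) \<inter> S) \<le> 1" by linarith
    qed
    moreover have "card H0 = Suc (card (H0 - {w}))" using f w by (metis card.remove)
    moreover have "esum H0 H0 = esum (H0 - {w}) (H0 - {w}) + 2 * dg w H"
      using esum_remove[OF f w(1)] H0(3) w(1) by simp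
    ultimately have m: "2 * card (M - {w}) + esum H0 H0 + 2 \<le> 2 * card H0 + 2 * dg w H"
      by linarith
    \<comment> \<open>Let n >= 1 be the number of components of \<open>H0\<close>. Then
      \<open>card (M - {w})\<close> is at most n + \<open>dg w H\<close> - 1 and the excess at most
      t - 1 - 2n. If w is a branch vertex, its degree cancels against its share of the excess;
      otherwise \<open>dg w H\<close> is at most 2 and w itself may be marked. Both ways the total
      is at most t + 1 - n.\<close>
    show ?thesis
    proof (cases "3 \<le> dg w H")
      case True
      then have "w \<notin> M" using assms(3) by force
      then have "card (M - {w}) = card M" by simp
      then show ?thesis using m e H0(4) card_branch_le(2)[OF f H0(2,1) w(1) True] by linarith
    next
      case False
      have "card M \<le> Suc (card (M - {w}))"
      proof (cases "w \<in> M")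
        case True
        then show ?thesis using card.remove[OF finM True] by linarith
      qed simp
      then show ?thesis using m e H0(4) card_branch_le(1)[OF f H0(2,1)] False by linarith
    qed
  qed
qed

subsection \<open>Cycles as periodic sequences\<close>

text \<open>With a p-periodic sequence over the integers every arc is the image of an interval,
  wherever it starts, and the other arc between the ends of i..j is j..i + p, without a case
  distinction at the wrap-around.\<close>

definition cyc :: "(int \<Rightarrow> 'a) \<Rightarrow> nat \<Rightarrow> bool" where
  "cyc c p \<longleftrightarrow> 3 \<le> p \<and> (\<forall>i j. c i = c j \<longleftrightarrow> int p dvd i - j) \<and> (\<forall>i. E (c i) (c (i + 1)))"

lemma cyc_edge: "cyc c p \<Longrightarrow> j = i + 1 \<Longrightarrow> E (c i) (c j)"
  unfolding cyc_def by blast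

lemma cyc_edge': "cyc c p \<Longrightarrow> j = i - 1 \<Longrightarrow> E (c i) (c j)"
  by (rule sym, rule cyc_edge) auto

lemma cyc_eq_iff: "cyc c p \<Longrightarrow> c i = c j \<longleftrightarrow> int p dvd i - j"
  unfolding cyc_def by blast

lemma cyc_inV: "cyc c p \<Longrightarrow> c i \<in> V"
  using cyc_edge inV by blast

lemma cyc_eq_near:
  assumes "cyc c p" "c i = c j" "\<bar>i - j\<bar> < int p" shows "i = j"
proof -
  have "int p dvd i - j" using assms cyc_eq_iff by blast
  then show ?thesis using assms(3) zdvd_imp_le[of "int p" "\<bar>i - j\<bar>"] by force
qed

lemma cyc_inj: "cyc c p \<Longrightarrow> j < i + int p \<Longrightarrow> inj_on c {i..j}"
  by (intro inj_onI) (rule cyc_eq_near[of c p], auto)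

lemma cyc_card_arc: "cyc c p \<Longrightarrow> j < i + int p \<Longrightarrow> card (c ` {i..j}) = nat (j + 1 - i)"
  by (subst card_image) (auto intro: cyc_inj)

lemma cyc_rep:
  assumes "cyc c p"
  obtains j where "i \<le> j" "j < i + int p" "c j = c k"
proof (rule that)
  have "0 < int p" using assms unfolding cyc_def by simp
  then show "i \<le> i + (k - i) mod int p" "i + (k - i) mod int p < i + int p" by simp_all
  have "int p dvd (k - i) mod int p - (k - i)" by (meson dvd_minus_mod dvd_diff_commute)
  then show "c (i + (k - i) mod int p) = c k"
    unfolding cyc_eq_iff[OF assms] by (simp add: algebra_simps)
qed

lemma cyc_range: "cyc c p \<Longrightarrow> range c = c ` {i..i + int p - 1}"
proof -
  assume c: "cyc c p"
  have "c k \<in> c ` {i..i + int p - 1}" for k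
  proof -
    obtain j where "i \<le> j" "j < i + int p" "c j = c k" using cyc_rep[OF c, of i k] .
    then show ?thesis by (intro image_eqI[of _ _ j]) auto
  qed
  then show ?thesis by auto
qed

lemma cyc_card: "cyc c p \<Longrightarrow> card (range c) = p"
  using cyc_range[of c p 0] cyc_card_arc[of c p "int p - 1" 0] by simp

lemma cyc_shift:
  assumes "cyc c p" shows "cyc (\<lambda>i. c (i + s)) p"
proof -
  have "E (c (i + s)) (c (i + 1 + s))" for i by (rule cyc_edge[OF assms]) simp
  then show ?thesis using assms unfolding cyc_def by simp
qed

lemma range_shift: "range (\<lambda>i. c (i + s)) = range (c :: int \<Rightarrow> 'a)"
proof -
  have "c i \<in> range (\<lambda>i. c (i + s))" for i by (rule range_eqI[of _ _ "i - s"]) simp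
  then show ?thesis by auto
qed

lemma coreI:
  assumes "finite K" "K \<noteq> {}"
    and "\<And>x. x \<in> K \<Longrightarrow> \<exists>y\<in>K. \<exists>z\<in>K. y \<noteq> z \<and> E x y \<and> E x z"
  shows "core K"
  unfolding core_def
proof (intro conjI ballI)
  show "K \<subseteq> V" using assms(3) inV by blast
  fix x assume "x \<in> K"
  then show "2 \<le> dg x K" using assms(3)[of x] dg_ge2I[OF assms(1)] by blast
qed (rule assms)

lemma cyc_core:
  assumes "cyc c p" shows "core (range c)"
proof (rule coreI)
  show "finite (range c)" using cyc_range[OF assms, of 0] by simp
  fix x assume "x \<in> range c"
  then obtain i where "x = c i" by blast
  moreover have "c (i + 1) \<noteq> c (i - 1)"
  proof
    assume "c (i + 1) = c (i - 1)"
    then have "i + 1 = i - 1" by (rule cyc_eq_near[OF assms]) (use assms in \<open>auto simp: cyc_def\<close>)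
    then show False by simp
  qed
  ultimately show "\<exists>y\<in>range c. \<exists>z\<in>range c. y \<noteq> z \<and> E x y \<and> E x z"
    using cyc_edge[OF assms refl, of i] cyc_edge'[OF assms refl, of i] by blast
qed simp

lemma arc_core:
  assumes "cyc c p" "i < j" "j < i + int p" "x \<notin> c ` {i..j}" "E x (c i)" "E x (c j)"
  shows "core (insert x (c ` {i..j}))"
proof (rule coreI)
  fix y assume "y \<in> insert x (c ` {i..j})"
  then consider "y = x" | m where "y = c m" "i \<le> m" "m \<le> j" by auto
  then show "\<exists>u\<in>insert x (c ` {i..j}). \<exists>v\<in>insert x (c ` {i..j}). u \<noteq> v \<and> E y u \<and> E y v"
  proof cases
    case 1
    have "c i \<noteq> c j" using cyc_eq_near[OF assms(1), of i j] assms(2,3) by auto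
    then show ?thesis using 1 assms by (intro bexI[of _ "c i"] bexI[of _ "c j"]) auto
  next
    case (2 m)
    define u where "u = (if m = i then x else c (m - 1))"
    define v where "v = (if m = j then x else c (m + 1))"
    have uv: "u \<in> insert x (c ` {i..j})" "v \<in> insert x (c ` {i..j})" using 2 unfolding u_def v_def by auto
    have "E y u" "E y v" unfolding u_def v_def 2(1)
      using sym[OF assms(5)] sym[OF assms(6)] cyc_edge[OF assms(1) refl, of m] cyc_edge'[OF assms(1) refl, of m]
      by auto
    moreover have "u \<noteq> v"
    proof
      assume "u = v"
      then have "m \<noteq> i" "m \<noteq> j" "c (m - 1) = c (m + 1)"
        using assms(2,4) 2 unfolding u_def v_def by (auto split: if_splits)
      then have "m - 1 = m + 1" by (intro cyc_eq_near[OF assms(1)]) (use assms(1) in \<open>auto simp: cyc_def\<close>)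
      then show False by simp
    qed
    ultimately show ?thesis using uv by blast
  qed
qed auto

lemma chord_core:
  assumes "cyc c p" "i + 2 \<le> j" "j < i + int p" "E (c i) (c j)"
  shows "core (c ` {i..j})"
proof -
  have "c i \<notin> c ` {i+1..j}"
  proof
    assume "c i \<in> c ` {i+1..j}"
    then obtain m where m: "c i = c m" "i + 1 \<le> m" "m \<le> j" by auto
    then have "i = m" using cyc_eq_near[OF assms(1) m(1)] assms(3) by linarith
    then show False using m by simp
  qed
  moreover have "insert (c i) (c ` {i+1..j}) = c ` {i..j}"
  proof -
    have "{i..j} = insert i {i+1..j}" using assms(2) by auto
    then show ?thesis by simp
  qed
  ultimately show ?thesis
    using arc_core[OF assms(1), of "i + 1" j "c i"] assms cyc_edge[OF assms(1) refl, of i] by auto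
qed

text \<open>All neighbours in K of the first vertex of a longest path lie on that path; the farther
  one of two such neighbours closes a cycle of length at least 3.\<close>

lemma core_cyc:
  assumes "core K"
  obtains c p where "cyc c p" "range c \<subseteq> K"
proof -
  have finK: "finite K" using assms finite_sub[of K] unfolding core_def by simp
  define P where "P xs \<longleftrightarrow> xs \<noteq> [] \<and> distinct xs \<and> set xs \<subseteq> K \<and>
    (\<forall>i. Suc i < length xs \<longrightarrow> E (xs ! i) (xs ! Suc i))" for xs
  obtain x where x: "x \<in> K" using assms unfolding core_def by blast
  have "P [x]" unfolding P_def using x by simp
  moreover have "\<forall>xs. P xs \<longrightarrow> length xs < Suc (card K)"
  proof (intro allI impI)
    fix xs assume "P xs"
    then have "distinct xs" "set xs \<subseteq> K" unfolding P_def by auto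
    then show "length xs < Suc (card K)"
      using card_mono[OF finK, of "set xs"] distinct_card[of xs] by simp
  qed
  ultimately have "\<exists>xs. P xs \<and> (\<forall>ys. P ys \<longrightarrow> length ys \<le> length xs)"
    by (rule ex_has_greatest_nat[of P "[x]" length])
  then obtain xs where xs: "P xs" "\<And>ys. P ys \<Longrightarrow> length ys \<le> length xs" by blast
  have ne: "xs \<noteq> []" and dist: "distinct xs" and sub: "set xs \<subseteq> K"
    and step: "\<And>i. Suc i < length xs \<Longrightarrow> E (xs ! i) (xs ! Suc i)"
    using xs(1) unfolding P_def by blast+
  have nb: "y \<in> set xs" if y: "y \<in> K" "E (xs ! 0) y" for y
  proof (rule ccontr)
    assume "y \<notin> set xs"
    then have "P (y # xs)" unfolding P_def
      using dist sub step y sym[OF y(2)] by (auto simp: nth_Cons split: nat.splits)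
    then show False using xs(2)[of "y # xs"] by simp
  qed
  have "xs ! 0 \<in> K" using ne sub by auto
  then have "2 \<le> dg (xs ! 0) K" using assms unfolding core_def by blast
  then obtain y z where yz: "y \<in> K" "z \<in> K" "y \<noteq> z" "E (xs ! 0) y" "E (xs ! 0) z"
    by (rule dg_ge2E)
  obtain a b where ab: "a < length xs" "b < length xs" "xs ! a = y" "xs ! b = z"
    using nb[OF yz(1,4)] nb[OF yz(2,5)] unfolding in_set_conv_nth by blast
  have "a \<noteq> b" "a \<noteq> 0" "b \<noteq> 0" using ab yz(3-5) irr[of "xs ! 0"] by (intro notI, simp)+
  define j where "j = max a b"
  have j: "2 \<le> j" "j < length xs" "E (xs ! j) (xs ! 0)"
    using ab yz(4,5) \<open>a \<noteq> b\<close> \<open>a \<noteq> 0\<close> \<open>b \<noteq> 0\<close> sym[OF yz(4)] sym[OF yz(5)] unfolding j_def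
    by (auto simp: max_def)
  define p where "p = Suc j"
  define c where "c i = xs ! nat (i mod int p)" for i
  have lt: "nat (i mod int p) < p" for i using pos_mod_bound[of "int p" i] unfolding p_def by linarith
  have "cyc c p"
    unfolding cyc_def
  proof (intro conjI allI)
    show "3 \<le> p" using j p_def by simp
    fix i k
    have "c i = c k \<longleftrightarrow> nat (i mod int p) = nat (k mod int p)"
      unfolding c_def
      using nth_eq_iff_index_eq[OF dist] lt[of i] lt[of k] j(2) unfolding p_def by simp
    also have "\<dots> \<longleftrightarrow> i mod int p = k mod int p" by (rule eq_nat_nat_iff) (simp_all add: p_def)
    also have "\<dots> \<longleftrightarrow> int p dvd i - k" by (rule mod_eq_dvd_iff)
    finally show "c i = c k \<longleftrightarrow> int p dvd i - k" .
  next
    fix i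
    define m where "m = nat (i mod int p)"
    have im: "i mod int p = int m" unfolding m_def p_def by simp
    show "E (c i) (c (i + 1))"
    proof (cases "Suc m < p")
      case True
      have "(i + 1) mod int p = (i mod int p + 1) mod int p" by (simp add: mod_simps)
      also have "\<dots> = int (Suc m)" using True im by simp
      finally have "c (i + 1) = xs ! Suc m" unfolding c_def by (simp only: nat_int)
      then show ?thesis using step[of m] True j p_def unfolding c_def m_def by simp
    next
      case False
      then have "m = j" using lt[of i] unfolding m_def p_def by linarith
      have "(i + 1) mod int p = (i mod int p + 1) mod int p" by (simp add: mod_simps)
      also have "\<dots> = int p mod int p" using im \<open>m = j\<close> p_def by (simp add: add.commute)
      finally have "c (i + 1) = xs ! 0" unfolding c_def by simp
      then show ?thesis using j(3) \<open>m = j\<close> unfolding c_def m_def by simp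
    qed
  qed
  moreover have "range c \<subseteq> K"
  proof
    fix y assume "y \<in> range c"
    then obtain i where "y = xs ! nat (i mod int p)" unfolding c_def by blast
    moreover have lt': "nat (i mod int p) < length xs" by (rule less_le_trans[OF lt]) (use j(2) in \<open>simp add: p_def\<close>)
    ultimately show "y \<in> K" using sub nth_mem[OF lt'] by auto
  qed
  ultimately show ?thesis using that by blast
qed

lemma minimal_core_cyc:
  assumes "core C" "\<forall>K\<subseteq>C. core K \<longrightarrow> card C \<le> card K"
  obtains c where "cyc c (card C)" "range c = C" "\<forall>v\<in>C. dg v C = 2"
proof -
  have finC: "finite C" using assms(1) finite_sub[of C] unfolding core_def by simp
  obtain c p where c: "cyc c p" "range c \<subseteq> C" using core_cyc assms(1) by blast
  have "card C \<le> card (range c)" using assms(2) c cyc_core by blast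
  then have r: "range c = C" using card_seteq finC c(2) by blast
  then have p: "p = card C" using cyc_card c(1) by blast
  have p3: "3 \<le> p" using c(1) unfolding cyc_def by blast
  have "dg v C = 2" if "v \<in> C" for v
  proof -
    have "v \<in> range c" using that r by simp
    then obtain i where i: "v = c i" by (rule rangeE)
    have "{y \<in> C. E v y} \<subseteq> {c (i + 1), c (i + int p - 1)}"
    proof
      fix y assume y: "y \<in> {y \<in> C. E v y}"
      then obtain k where "y = c k" using r by blast
      then obtain j where j: "i \<le> j" "j < i + int p" "c j = y" using cyc_rep[OF c(1)] by metis
      have "j \<noteq> i" using y i j irr by auto
      show "y \<in> {c (i + 1), c (i + int p - 1)}"
      proof (rule ccontr)
        assume "y \<notin> {c (i + 1), c (i + int p - 1)}"
        then have "j \<noteq> i + 1" "j \<noteq> i + int p - 1" using j by auto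
        then have jj: "i + 2 \<le> j" "j < i + int p - 1" using j \<open>j \<noteq> i\<close> by auto
        \<comment> \<open>A chord turns the arc between its ends into a core that misses at least
          one vertex of C, against minimality.\<close>
        have "core (c ` {i..j})" using chord_core[OF c(1) jj(1)] j y i by auto
        moreover have "c ` {i..j} \<subseteq> C" using r by auto
        ultimately have "card C \<le> card (c ` {i..j})" using assms(2) by blast
        then show False using cyc_card_arc[OF c(1), of j i] jj j p by linarith
      qed
    qed
    then have "dg v C \<le> card {c (i + 1), c (i + int p - 1)}"
      unfolding dg_def by (intro card_mono) auto
    also have "\<dots> \<le> 2" by (simp add: card_insert_if)
    finally have "dg v C \<le> 2" .
    moreover have "2 \<le> dg v C" using assms(1) that unfolding core_def by blast
    ultimately show ?thesis by linarith
  qed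
  then show ?thesis using that[OF _ r] c(1) p by simp
qed


subsection \<open>Packings of disjoint cycles\<close>

definition packing :: "'a set set \<Rightarrow> bool" where
  "packing \<C> \<longleftrightarrow> (\<forall>C\<in>\<C>. core C) \<and> (\<forall>C\<in>\<C>. \<forall>D\<in>\<C>. C \<noteq> D \<longrightarrow> C \<inter> D = {})"

lemma core_sub: "core K \<Longrightarrow> K \<subseteq> V"
  unfolding core_def by blast

lemma core_finite: "core K \<Longrightarrow> finite K"
  using core_sub finite_sub by blast

lemma core_nonempty: "core K \<Longrightarrow> K \<noteq> {}"
  unfolding core_def by blast

lemma packing_core: "packing \<C> \<Longrightarrow> C \<in> \<C> \<Longrightarrow> core C"
  unfolding packing_def by blast

lemma packing_disjoint: "packing \<C> \<Longrightarrow> C \<in> \<C> \<Longrightarrow> D \<in> \<C> \<Longrightarrow> C \<noteq> D \<Longrightarrow> C \<inter> D = {}"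
  unfolding packing_def by blast

lemma packing_finite: "packing \<C> \<Longrightarrow> finite \<C>"
proof -
  assume "packing \<C>"
  then have "\<C> \<subseteq> Pow V" using packing_core core_sub by blast
  then show ?thesis using finV finite_subset by blast
qed

lemma packing_subset: "packing \<C> \<Longrightarrow> \<D> \<subseteq> \<C> \<Longrightarrow> packing \<D>"
  unfolding packing_def by blast

lemma packing_card_Union: "packing \<C> \<Longrightarrow> card (\<Union>\<C>) = (\<Sum>C\<in>\<C>. card C)"
  using packing_disjoint[of \<C>] packing_core[of \<C>] core_finite
  by (intro card_Union_disjoint) (simp_all add: pairwise_def disjnt_def)

lemma packing_Un:
  assumes "packing \<C>" "packing \<D>" "\<Union>\<C> \<inter> \<Union>\<D> = {}"
  shows "packing (\<C> \<union> \<D>)" "card (\<C> \<union> \<D>) = card \<C> + card \<D>"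
proof -
  have *: "C \<inter> D = {}" "D \<inter> C = {}" if "C \<in> \<C>" "D \<in> \<D>" for C D
    using assms(3) that by auto
  show "packing (\<C> \<union> \<D>)"
    unfolding packing_def
  proof (intro conjI ballI impI)
    show "core C" if "C \<in> \<C> \<union> \<D>" for C using that assms(1,2) packing_core by auto
    show "C \<inter> D = {}" if "C \<in> \<C> \<union> \<D>" "D \<in> \<C> \<union> \<D>" "C \<noteq> D" for C D
      using that * packing_disjoint[OF assms(1), of C D] packing_disjoint[OF assms(2), of C D] by (elim UnE) simp_all
  qed
  have "\<C> \<inter> \<D> = {}"
  proof (rule ccontr)
    assume "\<C> \<inter> \<D> \<noteq> {}"
    then obtain C where "C \<in> \<C>" "C \<in> \<D>" by blast
    then show False using assms(3) core_nonempty[OF packing_core[OF assms(1)]] by blast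
  qed
  then show "card (\<C> \<union> \<D>) = card \<C> + card \<D>"
    using packing_finite assms by (simp add: card_Un_disjoint)
qed

lemma packing_single: "core C \<Longrightarrow> packing {C}"
  unfolding packing_def by simp

lemma packing_pair: "core C \<Longrightarrow> core D \<Longrightarrow> C \<inter> D = {} \<Longrightarrow> packing {C, D} \<and> card {C, D} = 2"
proof -
  assume a: "core C" "core D" "C \<inter> D = {}"
  then have "C \<noteq> D" using core_nonempty[of C] by auto
  then show ?thesis using a unfolding packing_def by auto
qed

lemma dg_Un_le: "finite S \<Longrightarrow> finite T \<Longrightarrow> dg x (S \<union> T) \<le> dg x S + dg x T"
proof -
  assume f: "finite S" "finite T"
  have "{y \<in> S \<union> T. E x y} = {y \<in> S. E x y} \<union> {y \<in> T. E x y}" by blast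
  then show ?thesis unfolding dg_def using card_Un_le by simp
qed

lemma esum_Un_le: "finite S \<Longrightarrow> finite T \<Longrightarrow> esum Y (S \<union> T) \<le> esum Y S + esum Y T"
  unfolding esum_def by (simp add: sum.distrib[symmetric] dg_Un_le sum_mono)

text \<open>An arc is a path, with at least one edge fewer than vertices; chords can only add to the
  left-out side of this count.\<close>

lemma arc_esum:
  assumes "cyc c p" "i \<le> j" "j < i + int p"
  shows "2 * card (c ` {i..j}) \<le> esum (c ` {i..j}) (c ` {i..j}) + 2"
proof -
  have "j < i + int p \<longrightarrow> 2 * card (c ` {i..j}) \<le> esum (c ` {i..j}) (c ` {i..j}) + 2"
    using assms(2)
  proof (induction j rule: int_ge_induct)
    case (step j)
    show ?case
    proof
      assume lt: "j + 1 < i + int p"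
      have "{i..j+1} = insert (j+1) {i..j}" using step.hyps by auto
      then have ins: "c ` {i..j+1} = insert (c (j+1)) (c ` {i..j})" by simp
      have notin: "c (j+1) \<notin> c ` {i..j}"
      proof
        assume "c (j+1) \<in> c ` {i..j}"
        then obtain m where m: "c (j+1) = c m" "i \<le> m" "m \<le> j" by auto
        then have "j + 1 = m" using cyc_eq_near[OF assms(1) m(1)] lt by linarith
        then show False using m by simp
      qed
      have "E (c (j+1)) (c j)" using cyc_edge'[OF assms(1), of j "j+1"] by simp
      then have "0 < dg (c (j+1)) (c ` {i..j})" using dg_pos_iff step.hyps by auto
      then show "2 * card (c ` {i..j+1}) \<le> esum (c ` {i..j+1}) (c ` {i..j+1}) + 2"
        using step lt notin unfolding ins by (simp add: esum_insert_insert)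
    qed
  qed simp
  then show ?thesis using assms(3) by blast
qed

lemma esum_Un_Un:
  assumes "finite S" "finite T" "S \<inter> T = {}"
  shows "esum (S \<union> T) (S \<union> T) = esum S S + esum T T + 2 * esum S T"
  using assms by (simp add: esum_Un_left esum_Un_right esum_swap[of T S])

end

subsection \<open>Extremal packings\<close>

text \<open>A counterexample together with its extremal packing. The bound in \<open>degs\<close> is
  2(k - 1)t + t + 1, just more than two neighbours on each of the k - 1 cycles and one in the
  remainder for each of t vertices.\<close>

locale cycle_packing = fin_graph +
  fixes k t :: nat and \<C> :: "'a set set"
  assumes k2: "2 \<le> k" and t5: "5 \<le> t" and cardV: "(2 * t - 1) * k \<le> card V"
    and degs: "\<And>X. X \<subseteq> V \<Longrightarrow> indep X \<Longrightarrow> card X = t \<Longrightarrow> (2 * k - 1) * t + 1 \<le> esum X V"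
    and pack: "packing \<C>" and cardC: "card \<C> + 1 = k"
    and shortest: "\<And>\<D>. packing \<D> \<Longrightarrow> card \<D> + 1 = k \<Longrightarrow> card (\<Union>\<C>) \<le> card (\<Union>\<D>)"
    and densest: "\<And>\<D>. packing \<D> \<Longrightarrow> card \<D> + 1 = k \<Longrightarrow> card (\<Union>\<D>) = card (\<Union>\<C>) \<Longrightarrow>
      esum (V - \<Union>\<D>) (V - \<Union>\<D>) \<le> esum (V - \<Union>\<C>) (V - \<Union>\<C>)"
    and maximal: "\<And>\<D>. packing \<D> \<Longrightarrow> card \<D> \<noteq> k"
begin

section \<open>The remainder H and exchanges against it\<close>

definition H where "H = V - \<Union>\<C>"

lemma C_core: "C \<in> \<C> \<Longrightarrow> core C"
  using pack packing_core by blast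

lemma C_fin: "C \<in> \<C> \<Longrightarrow> finite C"
  using C_core core_finite by blast

lemma C_sub: "C \<in> \<C> \<Longrightarrow> C \<subseteq> V"
  using C_core core_sub by blast

lemma C_H: "C \<in> \<C> \<Longrightarrow> C \<inter> H = {}"
  unfolding H_def by blast

lemma finC: "finite \<C>"
  using pack packing_finite by blast

lemma H_sub: "H \<subseteq> V"
  unfolding H_def by blast

lemma finH: "finite H"
  using H_sub finite_sub by blast

lemma V_eq: "V = \<Union>\<C> \<union> H"
  using C_sub unfolding H_def by blast

lemma card_H: "card V = (\<Sum>C\<in>\<C>. card C) + card H"
proof -
  have "finite (\<Union>\<C>)" using finC C_fin by blast
  moreover have "\<Union>\<C> \<inter> H = {}" unfolding H_def by blast
  ultimately have "card (\<Union>\<C> \<union> H) = card (\<Union>\<C>) + card H" using finH by (simp add: card_Un_disjoint)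
  then show ?thesis using V_eq packing_card_Union[OF pack] by simp
qed

lemma dg_V: "dg x V = (\<Sum>C\<in>\<C>. dg x C) + dg x H"
proof -
  have f: "finite (\<Union>\<C>)" using finC C_fin by blast
  have "\<Union>\<C> \<inter> H = {}" unfolding H_def by blast
  then have "dg x (\<Union>\<C> \<union> H) = dg x (\<Union>\<C>) + dg x H" using finH f by (simp add: dg_Un)
  moreover have "dg x (\<Union>\<C>) = (\<Sum>C\<in>\<C>. dg x C)"
    using finC C_fin packing_disjoint[OF pack] by (rule dg_UNION)
  ultimately show ?thesis using V_eq by simp
qed

lemma esum_V: "esum X V = (\<Sum>C\<in>\<C>. esum X C) + esum X H"
  unfolding esum_def dg_V by (simp add: sum.distrib sum.swap[of _ \<C> X])

text \<open>The common bookkeeping of all exchanges: new cycles may use the vertices of the removed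
  ones and of H, which no retained cycle touches.\<close>

lemma replace:
  assumes "\<A> \<subseteq> \<C>" "packing \<B>" "\<Union>\<B> \<subseteq> \<Union>\<A> \<union> H"
  shows "packing ((\<C> - \<A>) \<union> \<B>)" "card ((\<C> - \<A>) \<union> \<B>) + card \<A> = card \<C> + card \<B>"
    "card (\<Union>((\<C> - \<A>) \<union> \<B>)) + card (\<Union>\<A>) = card (\<Union>\<C>) + card (\<Union>\<B>)"
proof -
  have p: "packing (\<C> - \<A>)" "packing \<A>" using packing_subset[OF pack] assms(1) by auto
  have "\<Union>(\<C> - \<A>) \<inter> \<Union>\<A> = {}"
  proof -
    have "C \<inter> D = {}" if "C \<in> \<C> - \<A>" "D \<in> \<A>" for C D
      using packing_disjoint[OF pack, of C D] that assms(1) by blast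
    then show ?thesis by blast
  qed
  then have d1: "\<Union>(\<C> - \<A>) \<inter> \<Union>\<A> = {}" "\<Union>(\<C> - \<A>) \<inter> \<Union>\<B> = {}"
    using assms(3) unfolding H_def by blast+
  show r: "packing ((\<C> - \<A>) \<union> \<B>)" using packing_Un[OF p(1) assms(2) d1(2)] by simp
  have e: "(\<C> - \<A>) \<union> \<A> = \<C>" using assms(1) by blast
  show "card ((\<C> - \<A>) \<union> \<B>) + card \<A> = card \<C> + card \<B>"
    using packing_Un(2)[OF p(1) assms(2) d1(2)] packing_Un(2)[OF p d1(1)] unfolding e by simp
  have f: "finite (\<Union>(\<C> - \<A>))" "finite (\<Union>\<A>)" "finite (\<Union>\<B>)"
    using p assms(2) by (auto intro: packing_finite core_finite packing_core)
  have "card (\<Union>(\<C> - \<A>) \<union> \<Union>\<B>) = card (\<Union>(\<C> - \<A>)) + card (\<Union>\<B>)"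
    using f d1 by (simp add: card_Un_disjoint)
  moreover have "card (\<Union>(\<C> - \<A>) \<union> \<Union>\<A>) = card (\<Union>(\<C> - \<A>)) + card (\<Union>\<A>)"
    using f d1 by (simp add: card_Un_disjoint)
  moreover have "\<Union>(\<C> - \<A>) \<union> \<Union>\<A> = \<Union>\<C>" using assms(1) by blast
  moreover have "\<Union>((\<C> - \<A>) \<union> \<B>) = \<Union>(\<C> - \<A>) \<union> \<Union>\<B>" by blast
  ultimately show "card (\<Union>((\<C> - \<A>) \<union> \<B>)) + card (\<Union>\<A>) = card (\<Union>\<C>) + card (\<Union>\<B>)"
    by simp
qed

lemma acyc_H: "acyc H"
  unfolding acyc_def
proof (intro conjI allI impI notI)
  fix K assume K: "K \<subseteq> H" "core K"
  have d: "\<Union>{K} \<inter> \<Union>\<C> = {}" using K(1) unfolding H_def by auto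
  have "card ({K} \<union> \<C>) = k"
    using packing_Un(2)[OF packing_single[OF K(2)] pack d] cardC by simp
  then show False using maximal[OF packing_Un(1)[OF packing_single[OF K(2)] pack d]] by simp
qed (rule H_sub)

lemma replace_one:
  assumes "C \<in> \<C>" "core D" "D \<subseteq> C \<union> H"
  shows "card C \<le> card D"
proof -
  have a: "{C} \<subseteq> \<C>" "packing {D}" "\<Union>{D} \<subseteq> \<Union>{C} \<union> H"
    using assms packing_single by auto
  show ?thesis using shortest[OF replace(1)[OF a]] replace(2,3)[OF a] cardC by simp
qed

lemma no_two:
  assumes "C \<in> \<C>" "core D" "core D'" "D \<inter> D' = {}" "D \<subseteq> C \<union> H" "D' \<subseteq> C \<union> H"
  shows False
proof -
  have a: "{C} \<subseteq> \<C>" "packing {D, D'}" "\<Union>{D, D'} \<subseteq> \<Union>{C} \<union> H"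
    using assms packing_pair[OF assms(2-4)] by auto
  show ?thesis using maximal[OF replace(1)[OF a]] replace(2)[OF a] cardC packing_pair[OF assms(2-4)] by simp
qed

lemma replace_two:
  assumes "C \<in> \<C>" "C' \<in> \<C>" "C \<noteq> C'" "core D" "core D'" "D \<inter> D' = {}"
    "D \<subseteq> C \<union> C'" "D' \<subseteq> C \<union> C'"
  shows "card C + card C' \<le> card D + card D'"
proof -
  have a: "{C, C'} \<subseteq> \<C>" "packing {D, D'}" "\<Union>{D, D'} \<subseteq> \<Union>{C, C'} \<union> H"
    using assms packing_pair[OF assms(4-6)] by auto
  have CC: "C \<inter> C' = {}" using packing_disjoint[OF pack assms(1-3)] .
  have 1: "card {C, C'} = 2" using assms(3) by simp
  have 2: "card {D, D'} = 2" using packing_pair[OF assms(4-6)] by blast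
  have "card (\<Union>\<C>) \<le> card (\<Union>((\<C> - {C, C'}) \<union> {D, D'}))"
    by (rule shortest[OF replace(1)[OF a]]) (use replace(2)[OF a] cardC 1 2 in linarith)
  then have "card (\<Union>{C, C'}) \<le> card (\<Union>{D, D'})" using replace(3)[OF a] by linarith
  then show ?thesis
    using CC assms core_finite[OF assms(4)] core_finite[OF assms(5)] C_fin[OF assms(1)] C_fin[OF assms(2)]
    by (simp add: card_Un_disjoint)
qed

text \<open>The swap keeps the number of cycles and their total size, so \<open>densest\<close>
  applies: H loses the edges at x and gains those from v to the rest of H.\<close>

lemma exchange:
  assumes "C \<in> \<C>" "v \<in> C" "x \<in> H" "core (insert x (C - {v}))"
  shows "dg v (H - {x}) \<le> dg x H"
proof -
  let ?D = "insert x (C - {v})"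
  have a: "{C} \<subseteq> \<C>" "packing {?D}" "\<Union>{?D} \<subseteq> \<Union>{C} \<union> H"
    using assms packing_single by auto
  have xC: "x \<notin> C" using assms(3) C_H[OF assms(1)] by auto
  have "card ?D = card C"
    using xC card.remove[OF C_fin[OF assms(1)] assms(2)] C_fin[OF assms(1)] by (simp del: card_Diff_singleton)
  then have 1: "card (\<Union>((\<C> - {C}) \<union> {?D})) = card (\<Union>\<C>)" using replace(3)[OF a] by simp
  have 2: "card ((\<C> - {C}) \<union> {?D}) + 1 = k" using replace(2)[OF a] cardC by simp
  define R where "R = \<Union>(\<C> - {C})"
  have "C \<inter> C' = {}" if "C' \<in> \<C> - {C}" for C'
    using packing_disjoint[OF pack assms(1), of C'] that by auto
  then have CR: "C \<inter> R = {}" unfolding R_def by blast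
  have "\<Union>\<C> = C \<union> R" using assms(1) unfolding R_def by blast
  then have HR: "H = V - (C \<union> R)" unfolding H_def by simp
  have "\<Union>((\<C> - {C}) \<union> {?D}) = R \<union> ?D" unfolding R_def by (simp add: Un_commute)
  moreover have "V - (R \<union> ?D) = insert v (H - {x})"
    using assms(2,3) C_sub[OF assms(1)] CR xC unfolding HR by auto
  ultimately have V': "V - \<Union>((\<C> - {C}) \<union> {?D}) = insert v (H - {x})" by simp
  have "esum (insert v (H - {x})) (insert v (H - {x})) \<le> esum H H"
    using densest[OF replace(1)[OF a] 2 1] unfolding V' by (simp only: H_def)
  moreover have "v \<notin> H - {x}" using assms(2) C_H[OF assms(1)] by auto
  ultimately show ?thesis
    using esum_remove[OF finH assms(3)] finH by (simp add: esum_insert_insert)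
qed

lemma C_cyc:
  assumes "C \<in> \<C>"
  obtains c where "cyc c (card C)" "range c = C" "\<forall>v\<in>C. dg v C = 2"
proof -
  have "\<forall>K\<subseteq>C. core K \<longrightarrow> card C \<le> card K"
    by (intro allI impI replace_one[OF assms] le_supI1)
  then show thesis by (rule minimal_core_cyc[OF C_core[OF assms]]) (rule that)
qed

lemma card_C_ge3:
  assumes "C \<in> \<C>" shows "3 \<le> card C"
proof -
  obtain c where "cyc c (card C)" "range c = C" "\<forall>v\<in>C. dg v C = 2" by (rule C_cyc[OF assms])
  then show ?thesis unfolding cyc_def by (elim conjE)
qed

section \<open>Edges between H and a single cycle\<close>

text \<open>The two arcs between two neighbours of x, each closed by x, have
  \<open>card C + 4\<close> vertices together. By minimality each has at least
  \<open>card C\<close>, so C would have at most 4 vertices.\<close>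

lemma long_cycle_dg:
  assumes "C \<in> \<C>" "5 \<le> card C" "x \<in> H"
  shows "dg x C \<le> 1"
proof (rule ccontr)
  assume "\<not> dg x C \<le> 1"
  then have "2 \<le> dg x C" by simp
  then obtain y z where yz: "y \<in> C" "z \<in> C" "y \<noteq> z" "E x y" "E x z" by (rule dg_ge2E)
  obtain c where c: "cyc c (card C)" "range c = C" "\<forall>v\<in>C. dg v C = 2" by (rule C_cyc[OF assms(1)])
  let ?p = "int (card C)"
  have "y \<in> range c" "z \<in> range c" using yz c by auto
  then obtain i l where i: "y = c i" and l: "z = c l" by auto
  obtain j where j: "i \<le> j" "j < i + ?p" "c j = c l" by (rule cyc_rep[OF c(1)])
  have "i \<noteq> j" using yz i l j by auto
  then have ij: "i < j" using j by simp
  have xC: "x \<notin> C" using assms(3) C_H[OF assms(1)] by auto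
  then have x: "x \<notin> c ` {a..b}" for a b using c by auto
  have per: "c (i + ?p) = c i" using cyc_eq_iff[OF c(1), of "i + ?p" i] by simp
  have 1: "core (insert x (c ` {i..j}))"
    using arc_core[OF c(1) ij j(2) x] yz i l j(3) by simp
  have 2: "core (insert x (c ` {j..i + ?p}))"
    using arc_core[OF c(1), of j "i + ?p" x] x yz i l j per ij by simp
  have sub: "insert x (c ` A) \<subseteq> C \<union> H" for A using assms(3) c(2) by auto
  have "card C \<le> card (insert x (c ` {i..j}))" "card C \<le> card (insert x (c ` {j..i + ?p}))"
    using replace_one[OF assms(1) _ sub] 1 2 by auto
  moreover have "card (insert x (c ` {i..j})) = Suc (nat (j + 1 - i))"
    using x cyc_card_arc[OF c(1) j(2)] by simp
  moreover have "card (insert x (c ` {j..i + ?p})) = Suc (nat (i + ?p + 1 - j))"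
    using x cyc_card_arc[OF c(1), of "i + ?p" j] ij by simp
  ultimately show False using assms(2) ij j(2) by linarith
qed

lemma triangle_core:
  assumes "E x u" "E x w" "E u w"
  shows "core {x, u, w}"
proof (rule coreI)
  have "x \<noteq> u" "x \<noteq> w" "u \<noteq> w" using assms irr by auto
  then show "\<exists>a\<in>{x, u, w}. \<exists>b\<in>{x, u, w}. a \<noteq> b \<and> E y a \<and> E y b" if "y \<in> {x, u, w}" for y
    using that assms sym[OF assms(1)] sym[OF assms(2)] sym[OF assms(3)] by auto
qed auto

lemma quad_core:
  assumes "E a b" "E b c" "E c d" "E d a" "a \<noteq> c" "b \<noteq> d"
  shows "core {a, b, c, d}"
proof (rule coreI)
  show "\<exists>u\<in>{a, b, c, d}. \<exists>w\<in>{a, b, c, d}. u \<noteq> w \<and> E y u \<and> E y w" if "y \<in> {a, b, c, d}" for y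
    using that assms sym[OF assms(1)] sym[OF assms(2)] sym[OF assms(3)] sym[OF assms(4)] by auto
qed auto

lemma no_adjacent_neighbours:
  assumes "C \<in> \<C>" "4 \<le> card C" "x \<in> H" "u \<in> C" "w \<in> C" "E u w" "E x u"
  shows "\<not> E x w"
proof
  assume "E x w"
  then have "core {x, u, w}" using triangle_core assms by blast
  then have "card C \<le> card {x, u, w}" using replace_one[OF assms(1)] assms by simp
  also have "\<dots> \<le> 3" by (simp add: card_insert_if)
  finally show False using assms(2) by simp
qed

lemma triangle:
  assumes "C \<in> \<C>" "card C = 3"
  obtains u v w where "C = {u, v, w}" "u \<noteq> v" "v \<noteq> w" "u \<noteq> w" "E u v" "E v w" "E u w"
proof -
  obtain u v w where C: "C = {u, v, w}" "u \<noteq> v" "v \<noteq> w" "u \<noteq> w"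
    using assms(2) by (auto simp: card_3_iff)
  have "E a b" if "a \<in> C" "b \<in> C" "a \<noteq> b" for a b
  proof (rule ccontr)
    assume "\<not> E a b"
    then have "{y \<in> C. E a y} \<subseteq> C - {a, b}" using irr by auto
    then have "dg a C \<le> card (C - {a, b})" unfolding dg_def using C_fin[OF assms(1)] by (simp add: card_mono)
    also have "\<dots> = 1" using that assms C_fin[OF assms(1)] by (simp add: card_Diff_subset)
    finally show False using C_core[OF assms(1)] that unfolding core_def by fastforce
  qed
  then show ?thesis using that[of u v w] C by simp
qed

lemma quadrilateral:
  assumes "C \<in> \<C>" "card C = 4"
  obtains a b a' b' where "C = {a, b, a', b'}" "a \<noteq> a'" "b \<noteq> b'" "E a b" "E b a'" "E a' b'" "E b' a"
proof -
  obtain c where "cyc c (card C)" "range c = C" "\<forall>v\<in>C. dg v C = 2" by (rule C_cyc[OF assms(1)])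
  then have c: "cyc c 4" "range c = C" using assms(2) by auto
  have "{0..0 + int 4 - 1} = {0, 1, 2, 3::int}" by auto
  then have "C = {c 0, c 1, c 2, c 3}" using cyc_range[OF c(1), of 0] c(2) by simp
  moreover have "c 0 \<noteq> c 2" "c 1 \<noteq> c 3"
    using cyc_eq_near[OF c(1), of 0 2] cyc_eq_near[OF c(1), of 1 3] by auto
  moreover have "E (c 0) (c 1)" "E (c 1) (c 2)" "E (c 2) (c 3)"
    by (rule cyc_edge[OF c(1)], simp)+
  moreover have "c 0 = c 4" using cyc_eq_iff[OF c(1), of 0 4] by simp
  moreover have "E (c 3) (c 4)" by (rule cyc_edge[OF c(1)], simp)
  ultimately show ?thesis using that[of "c 0" "c 1" "c 2" "c 3"] by simp
qed

lemma quad_dg: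
  assumes "C \<in> \<C>" "card C = 4" "x \<in> H"
  shows "dg x C \<le> 2"
proof -
  obtain a b a' b' where q: "C = {a, b, a', b'}" "a \<noteq> a'" "b \<noteq> b'" "E a b" "E b a'" "E a' b'" "E b' a"
    by (rule quadrilateral[OF assms(1,2)])
  have na: "\<not> E x w" if "u \<in> C" "w \<in> C" "E u w" "E x u" for u w
    using no_adjacent_neighbours[OF assms(1) _ assms(3) that] assms(2) by simp
  have "{y \<in> C. E x y} \<subseteq> {a, a'} \<or> {y \<in> C. E x y} \<subseteq> {b, b'}"
  proof (cases "E x a \<or> E x a'")
    case True
    have "a \<in> C" "b \<in> C" "a' \<in> C" "b' \<in> C" unfolding q(1) by simp_all
    then have "\<not> E x b" "\<not> E x b'"
      using True na[of a b] na[OF _ _ sym[OF q(5)]] na[of a' b'] na[OF _ _ sym[OF q(7)]] q(4,6) by blast+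
    then show ?thesis unfolding q(1) by fast
  next
    case False
    then show ?thesis unfolding q(1) by fast
  qed
  moreover have "card {a, a'} \<le> 2" "card {b, b'} \<le> 2" by (simp_all add: card_insert_if)
  moreover have "card {y \<in> C. E x y} \<le> card {a, a'}" if "{y \<in> C. E x y} \<subseteq> {a, a'}"
    using that by (intro card_mono) auto
  moreover have "card {y \<in> C. E x y} \<le> card {b, b'}" if "{y \<in> C. E x y} \<subseteq> {b, b'}"
    using that by (intro card_mono) auto
  ultimately show ?thesis unfolding dg_def by linarith
qed

text \<open>Here C is a triangle completely joined to x, so x can be exchanged for any of its
  vertices; none of them may then have more than \<open>dg x H\<close> neighbours in H besides
  x.\<close>

lemma dg_C_ge3:
  assumes "C \<in> \<C>" "x \<in> H" "3 \<le> dg x C"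
  shows "esum C H \<le> 3 * (dg x H + 1)"
proof -
  have c3: "card C = 3"
  proof (rule ccontr)
    assume "card C \<noteq> 3"
    then consider "card C = 4" | "5 \<le> card C" using card_C_ge3[OF assms(1)] by linarith
    then show False
    proof cases
      case 1 then show ?thesis using quad_dg[OF assms(1) 1 assms(2)] assms(3) by linarith
    next
      case 2 then show ?thesis using long_cycle_dg[OF assms(1) 2 assms(2)] assms(3) by linarith
    qed
  qed
  have fC: "finite C" using C_fin assms(1) .
  have "{y \<in> C. E x y} = C"
  proof (rule card_seteq[OF fC])
    show "card C \<le> card {y \<in> C. E x y}" using assms(3) c3 unfolding dg_def by simp
  qed simp
  then have xC: "\<forall>y\<in>C. E x y" by blast
  obtain u v w where t: "C = {u, v, w}" "u \<noteq> v" "v \<noteq> w" "u \<noteq> w" "E u v" "E v w" "E u w"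
    by (rule triangle[OF assms(1) c3])
  have "E x u" "E x v" "E x w" using xC unfolding t(1) by simp_all
  then have cores: "core {x, v, w}" "core {x, u, w}" "core {x, u, v}"
    using t(5-7) by (simp_all add: triangle_core)
  have del: "C - {u} = {v, w}" "C - {v} = {u, w}" "C - {w} = {u, v}" using t(1-4) by auto
  have "core (insert x (C - {y}))" if "y \<in> C" for y
  proof -
    have "y = u \<or> y = v \<or> y = w" using that unfolding t(1) by simp
    then show ?thesis using del cores by (elim disjE) simp_all
  qed
  then have ex: "dg y (H - {x}) \<le> dg x H" if "y \<in> C" for y
    using that by (intro exchange[OF assms(1) that assms(2)])
  have "dg y H \<le> dg x H + 1" if "y \<in> C" for y
    using dg_remove[OF finH assms(2), of y] ex[OF that] by simp
  then have "esum C H \<le> (\<Sum>y\<in>C. dg x H + 1)" unfolding esum_def by (rule sum_mono)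
  then show ?thesis using c3 by simp
qed

text \<open>A vertex of X with three neighbours on C limits all edges between C and H to 3 * (2 + 1)
  = 9, which is less than 2 * 5. Otherwise every summand is at most 2, and equality forces 2
  throughout.\<close>

lemma esum_C_bound:
  assumes "C \<in> \<C>" "X \<subseteq> H" "\<And>x. x \<in> X \<Longrightarrow> dg x H \<le> 2" "5 \<le> card X"
  shows "esum X C \<le> 2 * card X"
    and "esum X C = 2 * card X \<Longrightarrow> x \<in> X \<Longrightarrow> dg x C = 2"
proof -
  have fX: "finite X" using assms(2) finH finite_subset by blast
  have fC: "finite C" using C_fin assms(1) .
  have small: "esum X C \<le> 9" if y: "y \<in> X" "3 \<le> dg y C" for y
  proof -
    have "y \<in> H" using y(1) assms(2) by auto
    have "esum X C = esum C X" using fX fC by (rule esum_swap)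
    also have "\<dots> \<le> esum C H" using fC finH assms(2) by (intro esum_mono) auto
    also have "\<dots> \<le> 3 * (dg y H + 1)" by (rule dg_C_ge3[OF assms(1) \<open>y \<in> H\<close> y(2)])
    also have "\<dots> \<le> 9" using assms(3)[OF y(1)] by simp
    finally show ?thesis .
  qed
  show le: "esum X C \<le> 2 * card X"
  proof (cases "\<exists>y\<in>X. 3 \<le> dg y C")
    case True
    then show ?thesis using small assms(4) by fastforce
  next
    case False
    then have "esum X C \<le> (\<Sum>x\<in>X. 2)" unfolding esum_def by (intro sum_mono) force
    then show ?thesis by simp
  qed
  show "dg x C = 2" if eq: "esum X C = 2 * card X" and x: "x \<in> X"
  proof -
    have le2: "dg y C \<le> 2" if "y \<in> X" for y
    proof (rule ccontr)
      assume "\<not> dg y C \<le> 2"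
      then have "esum X C \<le> 9" using small[OF that] by simp
      then show False using eq assms(4) by simp
    qed
    show ?thesis
    proof (rule ccontr)
      assume "dg x C \<noteq> 2"
      then have "dg x C < 2" using le2[OF x] by simp
      then have "(\<Sum>x\<in>X. dg x C) < (\<Sum>x\<in>X. 2)"
        using le2 x fX by (intro sum_strict_mono_ex1) auto
      then show False using eq unfolding esum_def by simp
    qed
  qed
qed

text \<open>Two neighbours on each cycle and one in H add up to (2k - 1)t for t vertices, one less
  than required.\<close>

lemma few_leaves:
  assumes "X \<subseteq> H" "indep X" "\<forall>x\<in>X. dg x H \<le> 1"
  shows "card X < t"
proof (rule ccontr)
  assume "\<not> card X < t"
  then obtain Y where Y: "Y \<subseteq> X" "card Y = t" by (meson not_less obtain_subset_with_card_n)
  have YH: "Y \<subseteq> H" using Y assms by blast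
  have d: "dg x H \<le> 1" if "x \<in> Y" for x using that Y assms(3) by blast
  have "esum Y H \<le> (\<Sum>x\<in>Y. 1)" unfolding esum_def using d by (intro sum_mono) auto
  moreover have "(\<Sum>C\<in>\<C>. esum Y C) \<le> (\<Sum>C\<in>\<C>. 2 * t)"
  proof (rule sum_mono)
    fix C assume "C \<in> \<C>"
    then have "esum Y C \<le> 2 * card Y"
      using YH d t5 Y(2) by (intro esum_C_bound(1)) fastforce+
    then show "esum Y C \<le> 2 * t" using Y(2) by simp
  qed
  moreover have "(2 * k - 1) * t + 1 \<le> esum Y V"
    using YH H_sub indep_subset[OF assms(2) Y(1)] Y(2) by (intro degs) auto
  ultimately have "(2 * k - 1) * t + 1 \<le> card \<C> * (2 * t) + t"
    using Y(2) unfolding esum_V by simp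
  moreover have "(2 * k - 1) * t = card \<C> * (2 * t) + t"
  proof -
    have "2 * k - 1 = 2 * card \<C> + 1" using cardC by linarith
    then show ?thesis by (simp add: algebra_simps)
  qed
  ultimately show False by linarith
qed

section \<open>Edges between two cycles of the packing\<close>

text \<open>Two edges between Y and the rest of C' would close a cycle there that, together with the
  cycle through x and the arc from u to w, is shorter than C and C' are.\<close>

lemma arc_pair_bound:
  assumes "C \<in> \<C>" "C' \<in> \<C>" "C \<noteq> C'"
    and c: "cyc c (card C)" "range c = C" and c': "cyc c' (card C')" "range c' = C'"
    and x: "x \<in> C" and Y: "Y = c ` {i..j}" "j < i + int (card C) - 2" "i \<le> j" "x \<notin> Y"
    and uw: "u < w" "w < u + int (card C')" "E x (c' u)" "E x (c' w)"
  shows "esum Y (C' - c' ` {u..w}) \<le> 1"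
proof (rule ccontr)
  assume *: "\<not> esum Y (C' - c' ` {u..w}) \<le> 1"
  let ?q = "int (card C')"
  define Z where "Z = c' ` {w+1..u + ?q - 1}"
  have CC: "C \<inter> C' = {}" by (rule packing_disjoint[OF pack assms(1-3)])
  have sub: "C' - c' ` {u..w} \<subseteq> Z"
  proof
    fix y assume y: "y \<in> C' - c' ` {u..w}"
    then have "y \<in> c' ` {u..u + ?q - 1}" using cyc_range[OF c'(1), of u] c'(2) by simp
    then obtain m where m: "y = c' m" "u \<le> m" "m \<le> u + ?q - 1" by auto
    have "\<not> m \<le> w" using y m by auto
    then show "y \<in> Z" using m unfolding Z_def by auto
  qed
  have finY: "finite Y" and finZ: "finite Z" unfolding Y(1) Z_def by auto
  have "esum Y (C' - c' ` {u..w}) \<le> esum Y Z" using sub finY finZ by (intro esum_mono) auto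
  then have e: "2 \<le> esum Y Z" using * by linarith
  have Zne: "w + 1 \<le> u + ?q - 1"
  proof (rule ccontr)
    assume "\<not> w + 1 \<le> u + ?q - 1"
    then have "Z = {}" unfolding Z_def by simp
    then show False using e unfolding esum_def by simp
  qed
  have YC: "Y \<subseteq> C" using c(2) Y(1) by auto
  have ZC: "Z \<subseteq> C'" using c'(2) unfolding Z_def by auto
  have disj: "Y \<inter> Z = {}" using YC ZC CC by blast
  have cY: "card Y = nat (j + 1 - i)" unfolding Y(1) using Y(2) by (intro cyc_card_arc[OF c(1)]) simp
  have cZ: "card Z = nat (u + ?q - 1 + 1 - (w + 1))" unfolding Z_def using uw by (intro cyc_card_arc[OF c'(1)]) simp
  have eY: "2 * card Y \<le> esum Y Y + 2" unfolding Y(1) using Y by (intro arc_esum[OF c(1)]) simp_all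
  have eZ: "2 * card Z \<le> esum Z Z + 2" unfolding Z_def using uw Zne by (intro arc_esum[OF c'(1)]) simp_all
  \<comment> \<open>Y and Z are paths, lacking at most one edge each against their number of
    vertices; the two edges between them make up for both.\<close>
  have "2 * card (Y \<union> Z) \<le> esum (Y \<union> Z) (Y \<union> Z)"
    using esum_Un_Un[OF finY finZ disj] card_Un_disjoint[OF finY finZ disj] eY eZ e by simp
  moreover have "Y \<union> Z \<subseteq> V" using YC ZC C_sub[OF assms(1)] C_sub[OF assms(2)] by blast
  moreover have "Y \<union> Z \<noteq> {}" using Y(1,3) by auto
  ultimately obtain D where D: "D \<subseteq> Y \<union> Z" "core D" using core_of_edges by blast
  let ?D' = "insert x (c' ` {u..w})"
  have x': "x \<notin> c' ` {u..w}" using x CC c'(2) by auto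
  have D': "core ?D'" using arc_core[OF c'(1) uw(1,2) x' uw(3,4)] .
  have cuw: "c' ` {u..w} \<subseteq> C'" using c'(2) by auto
  have Zd: "Z \<inter> c' ` {u..w} = {}"
  proof (rule ccontr)
    assume "Z \<inter> c' ` {u..w} \<noteq> {}"
    then obtain m m' where m: "c' m = c' m'" "w + 1 \<le> m" "m \<le> u + ?q - 1" "u \<le> m'" "m' \<le> w"
      unfolding Z_def by auto
    have "m = m'" by (rule cyc_eq_near[OF c'(1) m(1)]) (use m in linarith)
    then show False using m by simp
  qed
  have "D \<inter> ?D' = {}"
  proof -
    have "x \<notin> Z" using x CC ZC by blast
    moreover have "Y \<inter> c' ` {u..w} = {}" using YC cuw CC by blast
    ultimately show ?thesis using D(1) Zd Y(4) by auto
  qed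
  moreover have "D \<subseteq> C \<union> C'" "?D' \<subseteq> C \<union> C'" using D(1) YC ZC x cuw by auto
  ultimately have le: "card C + card C' \<le> card D + card ?D'"
    by (rule replace_two[OF assms(1-3) D(2) D'])
  have "card D \<le> card Y + card Z"
    using card_mono[OF _ D(1)] card_Un_disjoint[OF finY finZ disj] finY finZ by simp
  moreover have "card ?D' = Suc (nat (w + 1 - u))"
    using x' cyc_card_arc[OF c'(1) uw(2)] by simp
  \<comment> \<open>Y omits at least two vertices of C, and only x is put back; Z and the arc from u
    to w partition C'. So at least one vertex is saved.\<close>
  ultimately show False using le cY cZ uw Zne Y(2,3) by linarith
qed

text \<open>Three neighbours of x cut C' into three closed arcs. Each vertex of C' is missed by one
  of them, and the complement of each receives at most one edge from Y.\<close>

lemma three_neighbours_bound: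
  assumes "C \<in> \<C>" "C' \<in> \<C>" "C \<noteq> C'"
    and c: "cyc c (card C)" "range c = C"
    and x: "x \<in> C" "3 \<le> dg x C'" and Y: "Y = c ` {i..j}" "j < i + int (card C) - 2" "i \<le> j" "x \<notin> Y"
  shows "esum Y C' \<le> 3"
proof -
  obtain c' where c': "cyc c' (card C')" "range c' = C'" "\<forall>v\<in>C'. dg v C' = 2" by (rule C_cyc[OF assms(2)])
  let ?q = "int (card C')"
  obtain T where T: "T \<subseteq> {y \<in> C'. E x y}" "card T = 3"
    using x(2) unfolding dg_def by (meson obtain_subset_with_card_n)
  obtain y1 y2 y3 where y: "T = {y1, y2, y3}" "y1 \<noteq> y2" "y2 \<noteq> y3" "y1 \<noteq> y3" using T(2) by (auto simp: card_3_iff)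
  have "y1 \<in> range c'" "y2 \<in> range c'" "y3 \<in> range c'" using T(1) y(1) c'(2) by auto
  then obtain a1 a2 a3 where a: "y1 = c' a1" "y2 = c' a2" "y3 = c' a3" by auto
  obtain b2 where b2: "a1 \<le> b2" "b2 < a1 + ?q" "c' b2 = c' a2" by (rule cyc_rep[OF c'(1)])
  obtain b3 where b3: "a1 \<le> b3" "b3 < a1 + ?q" "c' b3 = c' a3" by (rule cyc_rep[OF c'(1)])
  have ne: "b2 \<noteq> a1" "b3 \<noteq> a1" "b2 \<noteq> b3" using y a b2 b3 by auto
  have nb: "E x (c' a1)" "E x (c' b2)" "E x (c' b3)" using T(1) y(1) a b2(3) b3(3) by auto
  define d where "d = min b2 b3"
  define e where "e = max b2 b3"
  have de: "a1 < d" "d < e" "e < a1 + ?q" using ne b2 b3 unfolding d_def e_def by auto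
  have nde: "E x (c' d)" "E x (c' e)" using nb unfolding d_def e_def by (auto simp: min_def max_def)
  have per: "c' (a1 + ?q) = c' a1" using cyc_eq_iff[OF c'(1), of "a1 + ?q" a1] by simp
  note ab = arc_pair_bound[OF assms(1-3) c c'(1,2) x(1) Y]
  have 1: "esum Y (C' - c' ` {a1..d}) \<le> 1" using de nb nde by (intro ab) auto
  have 2: "esum Y (C' - c' ` {d..e}) \<le> 1" using de nde by (intro ab) auto
  have 3: "esum Y (C' - c' ` {e..a1 + ?q}) \<le> 1" using de nb nde per by (intro ab) auto
  have cover: "C' \<subseteq> (C' - c' ` {a1..d}) \<union> ((C' - c' ` {d..e}) \<union> (C' - c' ` {e..a1 + ?q}))"
  proof
    fix v assume v: "v \<in> C'"
    then have "v \<in> range c'" using c'(2) by simp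
    then obtain m0 where m0: "v = c' m0" by auto
    obtain m where m: "a1 \<le> m" "m < a1 + ?q" "c' m = c' m0" by (rule cyc_rep[OF c'(1)])
    have "False" if vd: "v \<in> c' ` {a1..d}" and ve: "v \<in> c' ` {d..e}" and vq: "v \<in> c' ` {e..a1 + ?q}"
    proof -
      have vm: "v = c' m" using m0 m(3) by simp
      obtain n1 where n1: "c' m = c' n1" "a1 \<le> n1" "n1 \<le> d" using vd unfolding vm by auto
      obtain n2 where n2: "c' m = c' n2" "d \<le> n2" "n2 \<le> e" using ve unfolding vm by auto
      obtain n3 where n3: "c' m = c' n3" "e \<le> n3" "n3 \<le> a1 + ?q" using vq unfolding vm by auto
      note n = n1 n2 n3
      have "m = n1" by (rule cyc_eq_near[OF c'(1) n(1)]) (use n m de in linarith)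
      moreover have "m = n2" by (rule cyc_eq_near[OF c'(1) n(4)]) (use n m de in linarith)
      ultimately have "m = d" using n by linarith
      have "m = n3" by (rule cyc_eq_near[OF c'(1) n(7)]) (use n m de \<open>m = d\<close> in linarith)
      then show False using n de \<open>m = d\<close> by linarith
    qed
    then show "v \<in> (C' - c' ` {a1..d}) \<union> ((C' - c' ` {d..e}) \<union> (C' - c' ` {e..a1 + ?q}))" using v by blast
  qed
  have fin: "finite C'" "finite Y" using C_fin[OF assms(2)] Y(1) by auto
  have "esum Y C' \<le> esum Y ((C' - c' ` {a1..d}) \<union> ((C' - c' ` {d..e}) \<union> (C' - c' ` {e..a1 + ?q})))"
    using fin cover by (intro esum_mono) auto
  also have "\<dots> \<le> esum Y (C' - c' ` {a1..d}) + esum Y ((C' - c' ` {d..e}) \<union> (C' - c' ` {e..a1 + ?q}))"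
    using fin by (intro esum_Un_le) auto
  also have "esum Y ((C' - c' ` {d..e}) \<union> (C' - c' ` {e..a1 + ?q})) \<le> esum Y (C' - c' ` {d..e}) + esum Y (C' - c' ` {e..a1 + ?q})"
    using fin by (intro esum_Un_le) auto
  finally show ?thesis using 1 2 3 by linarith
qed

text \<open>If x has three neighbours on C', it accounts for at most \<open>card C'\<close> edges,
  its successor b for at most 3 and the arc Y for at most 3, and 6 is absorbed by
  \<open>card C\<close>. As an admissible arc omits two vertices of C, the vertex b needs the second
  arc \<open>Y'\<close>.\<close>

lemma two_cycles_bound:
  assumes "C \<in> \<C>" "C' \<in> \<C>" "C \<noteq> C'" "card C' \<le> card C" "6 \<le> card C"
  shows "esum C C' \<le> 2 * card C"
proof (cases "\<exists>x\<in>C. 3 \<le> dg x C'")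
  case False
  then have "dg x C' \<le> 2" if "x \<in> C" for x using that by force
  then have "esum C C' \<le> (\<Sum>x\<in>C. 2)" unfolding esum_def by (intro sum_mono)
  then show ?thesis by simp
next
  case True
  then obtain x where x: "x \<in> C" "3 \<le> dg x C'" by blast
  obtain c where c: "cyc c (card C)" "range c = C" "\<forall>v\<in>C. dg v C = 2" by (rule C_cyc[OF assms(1)])
  let ?p = "int (card C)"
  have "x \<in> range c" using x c(2) by simp
  then obtain i where i: "x = c i" by auto
  define b where "b = c (i + 1)"
  define Y where "Y = c ` {i+2..i + ?p - 1}"
  define Y' where "Y' = c ` {i+1..i + ?p - 2}"
  have notin: "x \<notin> c ` {l..r}" if "i < l" "r < i + ?p" for l r
  proof
    assume "x \<in> c ` {l..r}"
    then obtain m where m: "c i = c m" "l \<le> m" "m \<le> r" using i by auto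
    have "i = m" by (rule cyc_eq_near[OF c(1) m(1)]) (use m that in linarith)
    then show False using m that by linarith
  qed
  have "esum Y C' \<le> 3"
    using assms(5) notin[of "i+2" "i + ?p - 1"]
    by (intro three_neighbours_bound[OF assms(1-3) c(1,2) x, of Y "i+2" "i + ?p - 1"]) (simp_all add: Y_def)
  moreover have Y': "esum Y' C' \<le> 3"
    using assms(5) notin[of "i+1" "i + ?p - 2"]
    by (intro three_neighbours_bound[OF assms(1-3) c(1,2) x, of Y' "i+1" "i + ?p - 2"]) (simp_all add: Y'_def)
  have "b \<in> Y'" using assms(5) unfolding b_def Y'_def by auto
  then have "dg b C' \<le> esum Y' C'" unfolding esum_def by (intro member_le_sum) (simp_all add: Y'_def)
  then have "dg b C' \<le> 3" using Y' by linarith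
  moreover have "dg x C' \<le> card C'" using C_fin[OF assms(2)] by (rule dg_le_card)
  moreover have "esum C C' \<le> dg x C' + (dg b C' + esum Y C')"
  proof -
    have "{i..i + ?p - 1} = insert i (insert (i+1) {i+2..i + ?p - 1})" using assms(5) by auto
    then have "C = insert x (insert b Y)"
      using cyc_range[OF c(1), of i] c(2) i unfolding b_def Y_def by simp
    moreover have "finite Y" unfolding Y_def by simp
    ultimately show ?thesis
      using esum_insert_le[of "insert b Y" x C'] esum_insert_le[of Y b C'] by simp
  qed
  ultimately show ?thesis using assms(4,5) by linarith
qed


lemma induced_neighbours:
  assumes c: "cyc c (card C)" "range c = C" "\<forall>v\<in>C. dg v C = 2" and E: "E (c a) (c b)"
  shows "c b = c (a + 1) \<or> c b = c (a - 1)"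
proof -
  have p: "3 \<le> card C" using c(1) unfolding cyc_def by (elim conjE)
  have inC: "c i \<in> C" for i using c(2) by auto
  have fC: "finite C" by (rule ccontr) (use p in simp)
  have "c (a + 1) \<noteq> c (a - 1)"
  proof
    assume "c (a + 1) = c (a - 1)"
    then have "a + 1 = a - 1" by (rule cyc_eq_near[OF c(1)]) (use p in simp)
    then show False by simp
  qed
  then have two: "card {c (a + 1), c (a - 1)} = 2" by simp
  have "{c (a + 1), c (a - 1)} = {y \<in> C. E (c a) y}"
  proof (rule card_seteq)
    show "finite {y \<in> C. E (c a) y}" using fC by simp
    show "{c (a + 1), c (a - 1)} \<subseteq> {y \<in> C. E (c a) y}"
      using inC cyc_edge[OF c(1) refl] cyc_edge'[OF c(1) refl] by blast
    show "card {y \<in> C. E (c a) y} \<le> card {c (a + 1), c (a - 1)}"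
      using c(3) inC two unfolding dg_def by simp
  qed
  then have "c b \<in> {c (a + 1), c (a - 1)}" using E inC by blast
  then show ?thesis by simp
qed

text \<open>The degree condition is averaged over all rotations of a set of t vertices of C that are
  pairwise two steps apart.\<close>

lemma long_remainder:
  assumes "C \<in> \<C>" "\<forall>C'\<in>\<C>. card C' \<le> card C" "2 * t \<le> card C"
  shows "card C < card H"
proof -
  obtain c where c: "cyc c (card C)" "range c = C" "\<forall>v\<in>C. dg v C = 2" by (rule C_cyc[OF assms(1)])
  define p where "p = card C"
  have p: "2 * t \<le> p" "10 \<le> p" using assms(3) t5 unfolding p_def by auto
  have CV: "C \<subseteq> V" using C_sub[OF assms(1)] .
  have fC: "finite C" using C_fin[OF assms(1)] .
  have "esum C H = esum H C" using finH fC by (simp add: esum_swap)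
  also have "\<dots> \<le> (\<Sum>x\<in>H. 1)" unfolding esum_def
    using long_cycle_dg[OF assms(1)] p unfolding p_def by (intro sum_mono) simp
  finally have CH: "esum C H \<le> card H" by simp
  have CC: "esum C C' \<le> 2 * p" if "C' \<in> \<C>" for C'
  proof (cases "C' = C")
    case True
    then show ?thesis using c(3) unfolding esum_def p_def by simp
  next
    case False
    then show ?thesis
      using two_cycles_bound[OF assms(1) that] assms(2) that p unfolding p_def by auto
  qed
  have "(\<Sum>C'\<in>\<C>. esum C C') \<le> (\<Sum>C'\<in>\<C>. 2 * p)" using CC by (intro sum_mono)
  then have up: "esum C V \<le> card \<C> * (2 * p) + card H" using CH unfolding esum_V by simp
  define f where "f v = dg v V" for v
  have rot: "(\<Sum>i\<in>{0..int p - 1}. f (c (i + s))) = esum C V" for s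
  proof -
    have sh: "cyc (\<lambda>i. c (i + s)) p" using cyc_shift[OF c(1)] unfolding p_def .
    have inj: "inj_on (\<lambda>i. c (i + s)) {0..int p - 1}" by (rule cyc_inj[OF sh]) simp
    have "(\<lambda>i. c (i + s)) ` {0..int p - 1} = range (\<lambda>i. c (i + s))"
      using cyc_range[OF sh, of 0] by simp
    also have "\<dots> = C" using range_shift[of c s] c(2) by simp
    finally show ?thesis using sum.reindex[OF inj, of f] unfolding esum_def f_def by simp
  qed
  have low: "(2 * k - 1) * t + 1 \<le> (\<Sum>j\<in>{0..<t}. f (c (i + 2 * int j)))" for i
  proof -
    define X where "X = (\<lambda>j. c (i + 2 * int j)) ` {0..<t}"
    have inj: "inj_on (\<lambda>j. c (i + 2 * int j)) {0..<t}"
    proof (rule inj_onI)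
      fix a b assume ab: "a \<in> {0..<t}" "b \<in> {0..<t}" "c (i + 2 * int a) = c (i + 2 * int b)"
      have "i + 2 * int a = i + 2 * int b"
        by (rule cyc_eq_near[OF c(1) ab(3)]) (use ab p in \<open>auto simp: p_def\<close>)
      then show "a = b" by simp
    qed
    \<comment> \<open>C is chordless, the chosen indices differ by even numbers, and 2t <= p keeps
      the first and the last of them from being adjacent around the cycle.\<close>
    have "indep X"
      unfolding indep_def X_def
    proof (intro ballI notI)
      fix x y assume "x \<in> (\<lambda>j. c (i + 2 * int j)) ` {0..<t}" "y \<in> (\<lambda>j. c (i + 2 * int j)) ` {0..<t}" and xy: "E x y"
      then obtain a b where ab: "x = c (i + 2 * int a)" "y = c (i + 2 * int b)" "a < t" "b < t" by auto
      have "c (i + 2 * int b) = c (i + 2 * int a + 1) \<or> c (i + 2 * int b) = c (i + 2 * int a - 1)"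
        using induced_neighbours[OF c] xy ab by simp
      then show False
      proof
        assume e: "c (i + 2 * int b) = c (i + 2 * int a + 1)"
        have "i + 2 * int b = i + 2 * int a + 1"
          by (rule cyc_eq_near[OF c(1) e]) (use ab p in \<open>auto simp: p_def\<close>)
        then show False by presburger
      next
        assume e: "c (i + 2 * int b) = c (i + 2 * int a - 1)"
        have "i + 2 * int b = i + 2 * int a - 1"
          by (rule cyc_eq_near[OF c(1) e]) (use ab p in \<open>auto simp: p_def\<close>)
        then show False by presburger
      qed
    qed
    moreover have "X \<subseteq> V" using c(2) CV unfolding X_def by auto
    moreover have "card X = t" unfolding X_def using card_image[OF inj] by simp
    ultimately have "(2 * k - 1) * t + 1 \<le> esum X V" by (intro degs)
    also have "esum X V = (\<Sum>j\<in>{0..<t}. f (c (i + 2 * int j)))"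
      unfolding esum_def X_def f_def using sum.reindex[OF inj] by simp
    finally show ?thesis .
  qed
  have "p * ((2 * k - 1) * t + 1) = (\<Sum>i\<in>{0..int p - 1}. (2 * k - 1) * t + 1)" by simp
  also have "\<dots> \<le> (\<Sum>i\<in>{0..int p - 1}. \<Sum>j\<in>{0..<t}. f (c (i + 2 * int j)))"
    using low by (intro sum_mono)
  also have "\<dots> = (\<Sum>j\<in>{0..<t}. \<Sum>i\<in>{0..int p - 1}. f (c (i + 2 * int j)))" by (rule sum.swap)
  also have "\<dots> = t * esum C V" unfolding rot by simp
  also have "\<dots> \<le> t * (card \<C> * (2 * p) + card H)" using up by simp
  finally have main: "p * ((2 * k - 1) * t + 1) \<le> t * (card \<C> * (2 * p) + card H)" .
  have "2 * k - 1 = 2 * card \<C> + 1" using cardC by linarith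
  \<comment> \<open>Cancelling 2pt for each cycle leaves (t + 1)p <= t *
    \<open>card H\<close>.\<close>
  then have "t * p + p \<le> t * card H" using main by (simp add: algebra_simps)
  then have "t * p < t * card H" using p by linarith
  then show ?thesis unfolding p_def by (simp only: mult_less_cancel1)
qed

section \<open>Lengths of the cycles and size of H\<close>

lemma card_C: "card \<C> = k - 1"
  using cardC by linarith

text \<open>If a longest cycle has at most 2t - 1 vertices, the k - 1 cycles leave at least 2t - 1
  of the (2t - 1)k vertices. Otherwise \<open>long_remainder\<close> applies to it.\<close>

lemma remainder_large: "2 * t - 1 \<le> card H" "\<forall>C\<in>\<C>. card C \<le> card H"
proof -
  have "\<C> \<noteq> {}" using cardC k2 by auto
  then have "Max (card ` \<C>) \<in> card ` \<C>" using finC by (intro Max_in) auto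
  then obtain C where C: "C \<in> \<C>" "card C = Max (card ` \<C>)" by force
  have max: "\<forall>C'\<in>\<C>. card C' \<le> card C" using finC C(2) by simp
  have "2 * t - 1 \<le> card H \<and> card C \<le> card H"
  proof (cases "2 * t \<le> card C")
    case True
    then show ?thesis using long_remainder[OF C(1) max True] by linarith
  next
    case False
    have "(\<Sum>C\<in>\<C>. card C) \<le> (\<Sum>C\<in>\<C>. 2 * t - 1)" using max False by (intro sum_mono) fastforce
    then have "(2 * t - 1) * k \<le> (k - 1) * (2 * t - 1) + card H" using cardV card_H card_C by simp
    moreover have "(2 * t - 1) * k = (k - 1) * (2 * t - 1) + (2 * t - 1)"
    proof -
      have "k = Suc (k - 1)" using k2 by simp
      then show ?thesis by (metis mult.commute mult_Suc add.commute)
    qed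
    ultimately show ?thesis using False by linarith
  qed
  then show "2 * t - 1 \<le> card H" "\<forall>C\<in>\<C>. card C \<le> card H" using max le_trans by blast+
qed

lemma few_branches: "card {x\<in>H. 3 \<le> dg x H} + 3 \<le> t"
  using t5 by (intro branch_bound[OF acyc_H _ few_leaves]) simp_all

lemma degs_H:
  assumes "X \<subseteq> H" "indep X" "card X = t"
  shows "2 * card \<C> * t + t + 1 \<le> (\<Sum>C\<in>\<C>. esum X C) + esum X H"
proof -
  have "(2 * k - 1) * t + 1 \<le> esum X V" using assms H_sub by (intro degs) auto
  moreover have "2 * k - 1 = 2 * card \<C> + 1" using cardC by linarith
  then have "(2 * k - 1) * t + 1 = 2 * card \<C> * t + t + 1" by (simp only:) (simp add: algebra_simps)
  ultimately show ?thesis unfolding esum_V by (simp only:)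
qed

text \<open>A long cycle costs t edges against two per vertex, while t vertices of degree at most 2
  in H exceed one per vertex by at most t. So one long cycle is contradictory as soon as t such
  independent vertices exist; for this H must have 3t - 4 vertices.\<close>

lemma no_long_cycle:
  assumes "C0 \<in> \<C>" shows "card C0 \<le> 4"
proof (rule ccontr)
  assume long: "\<not> card C0 \<le> 4"
  define L where "L = {C\<in>\<C>. 5 \<le> card C}"
  define S where "S = {C\<in>\<C>. card C \<le> 4}"
  have LS: "\<C> = L \<union> S" "L \<inter> S = {}" "finite L" "finite S" using finC unfolding L_def S_def by auto
  then have kLS: "card \<C> = card L + card S" by (simp add: card_Un_disjoint)
  have "C0 \<in> L" using assms long unfolding L_def by simp
  then have z1: "1 \<le> card L" using LS(3) by (metis One_nat_def Suc_leI card_gt_0_iff empty_iff)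
  have sum_split: "(\<Sum>C\<in>\<C>. g C) = (\<Sum>C\<in>L. g C) + (\<Sum>C\<in>S. g C)" for g :: "'a set \<Rightarrow> nat"
    using LS by (simp add: sum.union_disjoint)
  have Lb: "(\<Sum>C\<in>L. esum X C) \<le> card L * card X" if X: "X \<subseteq> H" for X
  proof -
    have "esum X C \<le> card X" if "C \<in> L" for C
    proof -
      have C: "C \<in> \<C>" "5 \<le> card C" using that unfolding L_def by auto
      have "esum X C \<le> (\<Sum>x\<in>X. 1)" unfolding esum_def
        using X long_cycle_dg[OF C] by (intro sum_mono) auto
      then show ?thesis by simp
    qed
    then have "(\<Sum>C\<in>L. esum X C) \<le> (\<Sum>C\<in>L. card X)" by (intro sum_mono)
    then show ?thesis by simp
  qed
  \<comment> \<open>Only the degree sum of X in H is bounded here, so a short cycle may receive 3t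
    edges; the count merely shows that long cycles do not outnumber short ones.\<close>
  have sz: "card L \<le> card S"
  proof -
    obtain X where X: "X \<subseteq> H" "indep X" "card X = t" "esum X H \<le> 2 * t"
      by (rule acyc_indep_small_degree[OF acyc_H remainder_large(1)]) (use t5 in simp)
    have "esum X C \<le> 3 * t" if "C \<in> S" for C
    proof -
      have C: "C \<in> \<C>" "card C \<le> 4" using that unfolding S_def by auto
      have "dg x C \<le> 3" if "x \<in> X" for x
      proof (cases "card C = 4")
        case True
        then show ?thesis using quad_dg[OF C(1) True, of x] that X(1) by force
      next
        case False
        then show ?thesis using dg_le_card[OF C_fin[OF C(1)], of x] C(2) by linarith
      qed
      then have "esum X C \<le> (\<Sum>x\<in>X. 3)" unfolding esum_def by (intro sum_mono)
      then show ?thesis using X(3) by simp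
    qed
    then have "(\<Sum>C\<in>S. esum X C) \<le> (\<Sum>C\<in>S. 3 * t)" by (intro sum_mono)
    then have "2 * card \<C> * t + t + 1 \<le> card L * t + card S * (3 * t) + 2 * t"
      using degs_H[OF X(1-3)] Lb[OF X(1)] X(3,4) sum_split[of "esum X"] by simp
    then have "card L * t + 1 \<le> card S * t + t" unfolding kLS by (simp add: algebra_simps)
    then have "card L * t < (card S + 1) * t" by (simp only: add_mult_distrib)
    then have "card L < card S + 1" by (simp only: mult_less_cancel2)
    then show ?thesis by simp
  qed
  \<comment> \<open>Long cycles have at most \<open>card H\<close> vertices and short ones at most
    4. With no more long than short cycles, a smaller H could not bring the total up to (2t -
    1)k.\<close>
  have H: "3 * t - 4 \<le> card H"
  proof (rule ccontr)
    assume "\<not> 3 * t - 4 \<le> card H"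
    then have h: "card H \<le> 3 * t - 5" by simp
    have "(\<Sum>C\<in>L. card C) \<le> (\<Sum>C\<in>L. card H)"
      using remainder_large(2) unfolding L_def by (intro sum_mono) auto
    moreover have "(\<Sum>C\<in>S. card C) \<le> (\<Sum>C\<in>S. 4)" unfolding S_def by (intro sum_mono) auto
    ultimately have v: "(2 * t - 1) * k \<le> card L * card H + card S * 4 + card H"
      using cardV sum_split[of card] card_H by simp
    define z where "z = int (card L)"
    define s where "s = int (card S)"
    define n where "n = int (card H)"
    define r where "r = int t"
    have kk: "int k = z + s + 1" using kLS cardC unfolding z_def s_def by simp
    have i: "n \<le> 3 * r - 5" "5 \<le> r" "1 \<le> z" "z \<le> s"
      using h t5 z1 sz unfolding n_def r_def z_def s_def by auto
    have "int ((2 * t - 1) * k) \<le> int (card L * card H + card S * 4 + card H)" using v by (simp only: of_nat_le_iff)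
    then have "(2 * r - 1) * (z + s + 1) \<le> z * n + s * 4 + n"
      using t5 unfolding kk[symmetric] unfolding r_def z_def s_def n_def by (simp add: of_nat_diff)
    also have "\<dots> = (z + 1) * n + s * 4" by (simp add: algebra_simps)
    also have "\<dots> \<le> (z + 1) * (3 * r - 5) + s * 4" using i by (intro add_right_mono mult_left_mono) auto
    finally have "s * (2 * r - 5) \<le> (z + 1) * (r - 4)" by (simp add: algebra_simps)
    moreover have "z * (2 * r - 5) \<le> s * (2 * r - 5)" using i by (intro mult_right_mono) auto
    moreover have "(z + 1) * (r - 4) \<le> (2 * z) * (r - 4)" using i by (intro mult_right_mono) auto
    ultimately have "z * (2 * r - 5) \<le> 2 * z * (r - 4)" by linarith
    then have "z * 3 \<le> 0" by (simp add: algebra_simps)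
    then show False using i by simp
  qed
  define Q where "Q = {x\<in>H. dg x H \<le> 2}"
  define W where "W = {x\<in>H. 3 \<le> dg x H}"
  have fQW: "finite Q" "finite W" using finH unfolding Q_def W_def by auto
  have "H = Q \<union> W" unfolding Q_def W_def by auto
  then have "card H \<le> card Q + card W" using card_Un_le[of Q W] by simp
  \<comment> \<open>At most t - 3 vertices of H are branches, and 3t - 4 - (t - 3) = 2t - 1.\<close>
  then have Qc: "2 * t - 1 \<le> card Q" using H few_branches unfolding W_def by linarith
  have "acyc Q" by (rule acyc_subset[OF acyc_H]) (auto simp: Q_def)
  then obtain X where X: "X \<subseteq> Q" "indep X" "card X = t" by (rule acyc_indep_card[OF _ Qc])
  have XH: "X \<subseteq> H" using X(1) unfolding Q_def by auto
  have X2: "dg x H \<le> 2" if "x \<in> X" for x using X(1) that unfolding Q_def by auto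
  have "(\<Sum>C\<in>S. esum X C) \<le> (\<Sum>C\<in>S. 2 * t)"
  proof (rule sum_mono)
    fix C assume "C \<in> S"
    then have C: "C \<in> \<C>" unfolding S_def by simp
    have "5 \<le> card X" using X(3) t5 by simp
    then have "esum X C \<le> 2 * card X" by (intro esum_C_bound(1)[OF C XH] X2)
    then show "esum X C \<le> 2 * t" using X(3) by simp
  qed
  moreover have "esum X H \<le> (\<Sum>x\<in>X. 2)" unfolding esum_def using X2 by (intro sum_mono)
  ultimately have "2 * card \<C> * t + t + 1 \<le> card L * t + card S * (2 * t) + 2 * t"
    using degs_H[OF XH X(2,3)] Lb[OF XH] X(3) sum_split[of "esum X"] by simp
  then have "card L * t + 1 \<le> t" unfolding kLS by (simp add: algebra_simps)
  then have "card L * t < 1 * t" by linarith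
  then have "card L < 1" by (simp only: mult_less_cancel2)
  then show False using z1 by simp
qed


lemma esum_le2:
  assumes "finite X" "\<And>x. x \<in> X \<Longrightarrow> dg x T \<le> 2"
  shows "esum X T \<le> 2 * card X" and "esum X T = 2 * card X \<Longrightarrow> x \<in> X \<Longrightarrow> dg x T = 2"
proof -
  have "esum X T \<le> (\<Sum>x\<in>X. 2)" unfolding esum_def using assms(2) by (intro sum_mono)
  then show "esum X T \<le> 2 * card X" by simp
  show "dg x T = 2" if eq: "esum X T = 2 * card X" and x: "x \<in> X"
  proof (rule ccontr)
    assume "dg x T \<noteq> 2"
    then have "dg x T < 2" using assms(2)[OF x] by simp
    then have "(\<Sum>x\<in>X. dg x T) < (\<Sum>x\<in>X. 2)"
      using assms x by (intro sum_strict_mono_ex1) auto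
    then show False using eq unfolding esum_def by simp
  qed
qed

text \<open>With at most 4 vertices per cycle, H keeps (2t - 1)k - 4(k - 1) = (2t - 5)k + 4
  vertices, which is 4t - 6 for k = 2. A triangle or a larger k already gives 4t - 5.\<close>

lemma remainder_4t:
  shows "4 * t - 6 \<le> card H" and "card H < 4 * t - 5 \<Longrightarrow> C \<in> \<C> \<Longrightarrow> card C = 4 \<and> k = 2"
proof -
  have le: "(\<Sum>C\<in>\<C>. card C) \<le> (\<Sum>C\<in>\<C>. 4)" using no_long_cycle by (intro sum_mono)
  define r where "r = int t"
  define q where "q = int k"
  have i: "5 \<le> r" "2 \<le> q" using t5 k2 unfolding r_def q_def by auto
  have big: "(2 * r - 1) * q \<le> int (\<Sum>C\<in>\<C>. card C) + int (card H)"
  proof -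
    have "int ((2 * t - 1) * k) \<le> int ((\<Sum>C\<in>\<C>. card C) + card H)"
      using cardV card_H by (simp only: of_nat_le_iff)
    then show ?thesis using t5 unfolding r_def q_def by (simp add: of_nat_diff)
  qed
  have S: "int (\<Sum>C\<in>\<C>. card C) \<le> 4 * (q - 1)" using le card_C k2 unfolding q_def by (simp del: of_nat_sum)
  have mono: "(2 * r - 5) * m \<le> (2 * r - 5) * q" if "m \<le> q" for m
    using that i by (intro mult_left_mono) auto
  have "(2 * r - 5) * q + 4 \<le> int (card H)" using big S by (simp add: algebra_simps)
  then have b: "(2 * r - 5) * m + 4 \<le> int (card H)" if "m \<le> q" for m using mono[OF that] by linarith
  show "4 * t - 6 \<le> card H" using b[OF i(2)] unfolding r_def by simp
  show "card C = 4 \<and> k = 2" if h: "card H < 4 * t - 5" and C: "C \<in> \<C>"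
  proof -
    have k: "k = 2"
    proof (rule ccontr)
      assume "k \<noteq> 2"
      then have "3 \<le> q" using k2 unfolding q_def by simp
      then have "(2 * r - 5) * 3 + 4 \<le> int (card H)" by (rule b)
      then show False using h i unfolding r_def by simp
    qed
    have "card C = 4"
    proof (rule ccontr)
      assume "card C \<noteq> 4"
      then have "card C < 4" using no_long_cycle[OF C] by simp
      then have "(\<Sum>C\<in>\<C>. card C) < (\<Sum>C\<in>\<C>. 4)"
        using finC no_long_cycle C by (intro sum_strict_mono_ex1) auto
      then have "int (\<Sum>C\<in>\<C>. card C) + 1 \<le> 4 * (q - 1)" using card_C k2 unfolding q_def by (simp del: of_nat_sum)
      then have "(2 * r - 5) * q + 5 \<le> int (card H)" using big by (simp add: algebra_simps)
      then show False using h t5 k unfolding r_def q_def by simp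
    qed
    then show ?thesis using k by simp
  qed
qed

section \<open>Vertices of H that attain every bound\<close>

text \<open>Summing over M and all cycles leaves no slack in the bound of 2 neighbours per vertex and cycle,
  so that it is attained everywhere.\<close>

definition M where "M = {x\<in>H. 2 * k \<le> dg x V \<and> dg x H \<le> 2}"

definition W where "W = {x\<in>H. 3 \<le> dg x H}"

lemma M_H: "M \<subseteq> H"
  unfolding M_def by blast

lemma finM: "finite M"
  using M_H finH finite_subset by blast

text \<open>Of the vertices of total degree at most 2k - 1 no t can be independent, and in a forest
  this leaves room for at most 2t - 2 of them.\<close>

lemma card_H_split: "card H \<le> card M + card W + (2 * t - 2)"
proof -
  define L where "L = {x\<in>H. dg x V \<le> 2 * k - 1}"
  have "card L \<le> 2 * t - 2"
  proof (rule ccontr)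
    assume "\<not> card L \<le> 2 * t - 2"
    then have "2 * t - 1 \<le> card L" using t5 by linarith
    moreover have "acyc L" by (rule acyc_subset[OF acyc_H]) (auto simp: L_def)
    ultimately obtain X where X: "X \<subseteq> L" "indep X" "card X = t" using acyc_indep_card by blast
    have "esum X V \<le> (\<Sum>x\<in>X. 2 * k - 1)"
      unfolding esum_def using X(1) unfolding L_def by (intro sum_mono) auto
    then have "esum X V \<le> (2 * k - 1) * t" using X(3) by (simp add: mult.commute)
    moreover have "X \<subseteq> V" using X(1) H_sub unfolding L_def by auto
    ultimately show False using degs[OF _ X(2,3)] by fastforce
  qed
  moreover have "H \<subseteq> M \<union> W \<union> L" unfolding M_def W_def L_def by auto
  then have "card H \<le> card (M \<union> W \<union> L)" using finM finH unfolding W_def L_def by (intro card_mono) auto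
  moreover have "card (M \<union> W \<union> L) \<le> card M + card W + card L"
    using card_Un_le[of "M \<union> W" L] card_Un_le[of M W] by linarith
  ultimately show ?thesis by linarith
qed

lemma card_M: "card H + 5 \<le> card M + 3 * t"
  using card_H_split few_branches t5 unfolding W_def by linarith

lemma M_degrees:
  assumes "x \<in> M"
  shows "dg x H = 2" and "\<forall>C\<in>\<C>. dg x C = 2"
proof -
  have le: "esum M C \<le> 2 * card M \<and> (esum M C = 2 * card M \<longrightarrow> (\<forall>x\<in>M. dg x C = 2))" if C: "C \<in> \<C>" for C
  proof (cases "5 \<le> card M")
    case True
    have "dg x H \<le> 2" if "x \<in> M" for x using that unfolding M_def by blast
    then show ?thesis using esum_C_bound[OF C M_H _ True] by blast
  next
    case False
    \<comment> \<open>A set M of at most 4 vertices puts H below 4t - 5; then all cycles are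
      4-cycles, where the bound 2 holds for each vertex of H separately.\<close>
    then have "card H < 4 * t - 5" using card_M t5 by linarith
    then have c4: "card C = 4" using remainder_4t(2) C by blast
    have d: "dg x C \<le> 2" if "x \<in> M" for x using quad_dg[OF C c4, of x] that M_H by blast
    show ?thesis using esum_le2[OF finM d] by blast
  qed
  have MH: "esum M H \<le> 2 * card M" unfolding M_def by (rule esum_le2(1)) (use finH in auto)
  have "(\<Sum>x\<in>M. 2 * k) \<le> esum M V" unfolding esum_def M_def by (intro sum_mono) auto
  then have lower: "2 * k * card M \<le> (\<Sum>C\<in>\<C>. esum M C) + esum M H" unfolding esum_V by (simp add: mult.commute)
  have kk: "2 * k * card M = card \<C> * (2 * card M) + 2 * card M"
  proof -
    have "k = card \<C> + 1" using cardC by simp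
    then show ?thesis by (simp add: algebra_simps)
  qed
  have upper: "(\<Sum>C\<in>\<C>. esum M C) \<le> (\<Sum>C\<in>\<C>. 2 * card M)" using le by (intro sum_mono) blast
  then have "esum M H = 2 * card M" using lower kk MH by simp
  then show "dg x H = 2" using esum_le2(2)[OF finM _ _ assms, of H] unfolding M_def by auto
  show "\<forall>C\<in>\<C>. dg x C = 2"
  proof (rule ccontr)
    assume "\<not> (\<forall>C\<in>\<C>. dg x C = 2)"
    then obtain C where C: "C \<in> \<C>" "dg x C \<noteq> 2" by blast
    then have "esum M C < 2 * card M" using le[OF C(1)] assms by (metis le_neq_implies_less)
    then have "(\<Sum>C\<in>\<C>. esum M C) < (\<Sum>C\<in>\<C>. 2 * card M)"
      using finC C(1) le by (intro sum_strict_mono_ex1) auto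
    then show False using lower kk MH by simp
  qed
qed

text \<open>Since x is not adjacent to v, the swap keeps all neighbours of v in H, and x has only
  two.\<close>

lemma exchange_M:
  assumes "C \<in> \<C>" "v \<in> C" "x \<in> M" "core (insert x (C - {v}))" "\<not> E x v"
  shows "dg v H \<le> 2"
proof -
  have x: "x \<in> H" using assms(3) M_H by blast
  have "\<not> E v x" using assms(5) sym[of v x] by blast
  then have "dg v H = dg v (H - {x})" using dg_remove[OF finH x, of v] by simp
  then show ?thesis using exchange[OF assms(1,2) x assms(4)] M_degrees(1)[OF assms(3)] by simp
qed

lemma card_M_nbrs: "card {x\<in>M. E x v} \<le> dg v H"
proof -
  have "{x\<in>M. E x v} \<subseteq> {y\<in>H. E v y}" using M_H sym by blast
  then show ?thesis unfolding dg_def using finH by (intro card_mono) auto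
qed

text \<open>A vertex of C avoided by some member of M can be exchanged for that member and so has at
  most two neighbours in M. If M did not agree on one pair, two such neighbourhoods would cover M,
  leaving it at most 4 vertices.\<close>

lemma common_neighbours:
  assumes C: "C \<in> \<C>"
  obtains u v where "u \<in> C" "v \<in> C" "u \<noteq> v" "\<forall>x\<in>M. E x u \<and> E x v"
proof -
  have dgC: "dg x C = 2" if "x \<in> M" for x using M_degrees(2)[OF that] C by blast
  have "card C = 3 \<or> card C = 4" using card_C_ge3[OF C] no_long_cycle[OF C] by linarith
  then show thesis
  proof
    assume c3: "card C = 3"
    obtain u v w where t: "C = {u, v, w}" "u \<noteq> v" "v \<noteq> w" "u \<noteq> w" "E u v" "E v w" "E u w"
      by (rule triangle[OF C c3])
    have "\<not> card H < 4 * t - 5" using remainder_4t(2)[OF _ C] c3 by auto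
    then have M5: "5 \<le> card M" using card_M t5 by linarith
    have two: "(if E x u then 1 else 0) + ((if E x v then 1 else 0) + (if E x w then 1 else 0)) = (2::nat)"
      if "x \<in> M" for x
      using dgC[OF that] t(2-4) unfolding t(1) by (simp add: dg_insert)
    have few: "card {x\<in>M. E x y} \<le> 2" if y: "y \<in> C" and x: "x \<in> M" "\<not> E x y" for x y
    proof -
      have del: "C - {u} = {v, w}" "C - {v} = {u, w}" "C - {w} = {u, v}" using t(1-4) by auto
      have "y = u \<or> y = v \<or> y = w" using y unfolding t(1) by simp
      then have "core (insert x (C - {y}))"
        using two[OF x(1)] x(2) del triangle_core[of x v w] triangle_core[of x u w] triangle_core[of x u v] t(5-7)
        by (elim disjE) (simp_all split: if_splits)
      then have "dg y H \<le> 2" by (rule exchange_M[OF C y x(1) _ x(2)])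
      then show ?thesis using card_M_nbrs[of y] by linarith
    qed
    have all: "(\<forall>x\<in>M. E x a) \<or> (\<forall>x\<in>M. E x b)" if "a \<in> C" "b \<in> C" "a \<noteq> b" for a b
    proof (rule ccontr)
      assume "\<not> ((\<forall>x\<in>M. E x a) \<or> (\<forall>x\<in>M. E x b))"
      then obtain x y where "x \<in> M" "\<not> E x a" "y \<in> M" "\<not> E y b" by blast
      then have f: "card {x\<in>M. E x a} \<le> 2" "card {x\<in>M. E x b} \<le> 2" using few that by blast+
      have "E z a \<or> E z b" if z: "z \<in> M" for z
        using two[OF z] \<open>a \<in> C\<close> \<open>b \<in> C\<close> \<open>a \<noteq> b\<close> unfolding t(1) by (auto split: if_splits)
      then have "M = {x\<in>M. E x a} \<union> {x\<in>M. E x b}" by blast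
      then have "card M \<le> card {x\<in>M. E x a} + card {x\<in>M. E x b}" using card_Un_le by metis
      then show False using f M5 by linarith
    qed
    have "u \<in> C" "v \<in> C" "w \<in> C" unfolding t(1) by simp_all
    then show thesis using all[of u v] all[of v w] all[of u w] t(2-4) that[of u v] that[of v w] that[of u w]
      by blast
  next
    assume c4: "card C = 4"
    obtain a b a' b' where q: "C = {a, b, a', b'}" "a \<noteq> a'" "b \<noteq> b'" "E a b" "E b a'" "E a' b'" "E b' a"
      by (rule quadrilateral[OF C c4])
    have inC: "a \<in> C" "b \<in> C" "a' \<in> C" "b' \<in> C" unfolding q(1) by simp_all
    have ne: "a \<noteq> b" "b \<noteq> a'" "a' \<noteq> b'" "b' \<noteq> a" using q(4-7) irr by auto
    have type: "E x a \<and> E x a' \<and> \<not> E x b \<and> \<not> E x b' \<or> \<not> E x a \<and> \<not> E x a' \<and> E x b \<and> E x b'" if x: "x \<in> M" for x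
    proof -
      have xH: "x \<in> H" using x M_H by blast
      have na: "\<not> (E x u \<and> E x w)" if "u \<in> C" "w \<in> C" "E u w" for u w
        using no_adjacent_neighbours[OF C _ xH that] c4 by simp
      have "(if E x a then 1 else 0) + ((if E x b then 1 else 0) + ((if E x a' then 1 else 0) + (if E x b' then 1 else 0))) = (2::nat)"
        using dgC[OF x] ne q(2,3) unfolding q(1) by (simp add: dg_insert)
      then show ?thesis
        using na[OF inC(1,2) q(4)] na[OF inC(2,3) q(5)] na[OF inC(3,4) q(6)] na[OF inC(4,1) q(7)]
        by (simp split: if_splits)
    qed
    have del: "C - {a} = {b, a', b'}" "C - {b} = {a, a', b'}" "C - {a'} = {a, b, b'}" "C - {b'} = {a, b, a'}"
      using q(1-3) ne by auto
    have xC: "x \<notin> C" if "x \<in> M" for x using that M_H C_H[OF C] by blast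
    have A: "dg b H \<le> 2" "dg b' H \<le> 2" if x: "x \<in> M" "E x a" for x
    proof -
      have xx: "E x a'" "\<not> E x b" "\<not> E x b'" using type[OF x(1)] x(2) by auto
      have n: "x \<noteq> b" "x \<noteq> b'" using xC[OF x(1)] inC by auto
      have "core {x, a, b, a'}" by (rule quad_core) (use x xx n q sym[OF xx(1)] in simp_all)
      moreover have "core {x, a, b', a'}"
        by (rule quad_core) (use x xx n q sym[OF xx(1)] sym[OF q(6)] sym[OF q(7)] in simp_all)
      ultimately have "core (insert x (C - {b'}))" "core (insert x (C - {b}))"
        unfolding del by (simp_all add: insert_commute)
      then show "dg b H \<le> 2" "dg b' H \<le> 2" using exchange_M[OF C _ x(1)] inC xx by blast+
    qed
    have B: "dg a H \<le> 2" "dg a' H \<le> 2" if x: "x \<in> M" "E x b" for x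
    proof -
      have xx: "E x b'" "\<not> E x a" "\<not> E x a'" using type[OF x(1)] x(2) by auto
      have n: "x \<noteq> a" "x \<noteq> a'" using xC[OF x(1)] inC by auto
      have "core {x, b, a', b'}" by (rule quad_core) (use x xx n q sym[OF xx(1)] in simp_all)
      moreover have "core {x, b, a, b'}"
        by (rule quad_core) (use x xx n q sym[OF xx(1)] sym[OF q(4)] sym[OF q(7)] in simp_all)
      ultimately have "core (insert x (C - {a}))" "core (insert x (C - {a'}))"
        unfolding del by (simp_all add: insert_commute)
      then show "dg a H \<le> 2" "dg a' H \<le> 2" using exchange_M[OF C _ x(1)] inC xx by blast+
    qed
    show thesis
    proof (cases "(\<forall>x\<in>M. E x a) \<or> (\<forall>x\<in>M. E x b)")
      case True
      then show thesis using type that[OF inC(1,3) q(2)] that[OF inC(2,4) q(3)] by blast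
    next
      case False
      then obtain x y where xy: "x \<in> M" "E x b" "y \<in> M" "E y a" using type by blast
      have dgs: "dg a H \<le> 2" "dg b H \<le> 2" "dg a' H \<le> 2" "dg b' H \<le> 2" using A[OF xy(3,4)] B[OF xy(1,2)] by auto
      have "M = {x\<in>M. E x a} \<union> {x\<in>M. E x b}" using type by blast
      then have "card M \<le> card {x\<in>M. E x a} + card {x\<in>M. E x b}" using card_Un_le by metis
      then have M4: "card M \<le> 4" using card_M_nbrs[of a] card_M_nbrs[of b] dgs by linarith
      \<comment> \<open>Now 4t - 6 <= \<open>card H\<close> <= 3t - 1, which forces t = 5 and
        equality on both sides.\<close>
      have t: "t = 5" "card H = 14" "card M = 4" using M4 card_M remainder_4t(1) t5 by linarith+
      then have k: "k = 2" using remainder_4t(2)[OF _ C] by simp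
      then have "card \<C> = 1" using cardC by simp
      then have CC: "\<C> = {C}" using C by (auto simp: card_1_singleton_iff)
      \<comment> \<open>M alone takes up all 8 edges between C and H, so the other 10 vertices of H
        send none to C. Five independent ones among them would need degree sum 16 inside H, which
        has at most 13 edges.\<close>
      have "esum C H \<le> 8" using dgs ne q(2,3) unfolding esum_def q(1) by simp
      then have HC: "esum H C \<le> 8" using esum_swap[OF finH C_fin[OF C]] by simp
      have "esum M C = 8" using dgC t(3) unfolding esum_def by simp
      moreover have "esum H C = esum M C + esum (H - M) C"
        using esum_Un_left[OF finM, of "H - M" C] finH M_H by (simp add: Un_absorb1)
      ultimately have zero: "esum (H - M) C = 0" using HC by simp
      have "card (H - M) = 10" using t M_H finM by (simp add: card_Diff_subset)
      then have "2 * t - 1 \<le> card (H - M)" using t by simp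
      moreover have "acyc (H - M)" by (rule acyc_subset[OF acyc_H]) blast
      ultimately obtain X where X: "X \<subseteq> H - M" "indep X" "card X = t" using acyc_indep_card by blast
      have XH: "X \<subseteq> H" using X(1) by blast
      have "esum X C \<le> esum (H - M) C" using X(1) finH C_fin[OF C] by (intro esum_mono) auto
      then have "esum X V = esum X H" using zero unfolding esum_V CC by simp
      moreover have "(2 * k - 1) * t + 1 \<le> esum X V" using XH H_sub X(2,3) by (intro degs) auto
      moreover have "H \<noteq> {}" using t(2) by auto
      moreover have "2 * esum X H \<le> esum H H" by (rule indep_degree_sum[OF acyc_H XH X(2)])
      moreover have "esum H H + 2 \<le> 2 * card H" by (rule acyc_edges[OF acyc_H \<open>H \<noteq> {}\<close>])
      ultimately have False using t k by simp
      then show thesis ..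
    qed
  qed
qed

lemma contradiction: False
proof -
  have "\<C> \<noteq> {}" using cardC k2 by auto
  then obtain C where C: "C \<in> \<C>" by blast
  obtain u v where uv: "u \<in> C" "v \<in> C" "u \<noteq> v" "\<forall>x\<in>M. E x u \<and> E x v" by (rule common_neighbours[OF C])
  \<comment> \<open>A common neighbour of M closes a cycle with any connected part of H that
    contains two vertices of M; u and v do so independently of each other.\<close>
  have hit: "\<exists>D\<subseteq>insert w S. core D" if S: "S \<subseteq> H" "conn S" "2 \<le> card (M \<inter> S)" and w: "w \<in> C" "\<forall>x\<in>M. E x w" for S w
  proof -
    have fS: "finite S" using S(1) finH finite_subset by blast
    have "M \<inter> S \<subseteq> {y\<in>S. E w y}" using w(2) sym by blast
    then have "card (M \<inter> S) \<le> dg w S" unfolding dg_def using fS by (intro card_mono) auto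
    then have "2 \<le> dg w S" using S(3) by linarith
    moreover have "S \<subseteq> V" "w \<in> V" "w \<notin> S" using S(1) w(1) H_sub C_sub[OF C] C_H[OF C] by auto
    ultimately obtain D where "D \<subseteq> insert w S" "core D" using conn_core[OF S(2)] by blast
    then show ?thesis by blast
  qed
  have "card M + card {x\<in>H. 3 \<le> dg x H} \<le> t"
  proof (rule marks_and_branches[OF acyc_H M_H M_degrees(1) _ few_leaves])
    show "3 \<le> t" using t5 by simp
    fix S T assume ST: "S \<subseteq> H" "T \<subseteq> H" "conn S" "conn T" "2 \<le> card (M \<inter> S)" "2 \<le> card (M \<inter> T)"
    show "S \<inter> T \<noteq> {}"
    proof
      assume disj: "S \<inter> T = {}"
      obtain D where D: "D \<subseteq> insert u S" "core D" using hit[OF ST(1,3,5) uv(1)] uv(4) by blast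
      obtain D' where D': "D' \<subseteq> insert v T" "core D'" using hit[OF ST(2,4,6) uv(2)] uv(4) by blast
      have "u \<notin> T" "v \<notin> S" using ST(1,2) uv(1,2) C_H[OF C] by auto
      then have "D \<inter> D' = {}" using D(1) D'(1) disj uv(3) by blast
      moreover have "D \<subseteq> C \<union> H" "D' \<subseteq> C \<union> H" using D(1) D'(1) ST(1,2) uv(1,2) by auto
      ultimately show False using no_two[OF C D(2) D'(2)] by blast
    qed
  qed
  \<comment> \<open>Now \<open>card H\<close> is at most t + (2t - 2) = 3t - 2, which is below 4t -
    6.\<close>
  then show False using card_H_split remainder_4t(1) t5 unfolding W_def by linarith
qed


end

section \<open>Induction on the number of cycles\<close>

context fin_graph begin

lemma packing_step:
  assumes "2 \<le> k" "5 \<le> t" "(2 * t - 1) * k \<le> card V"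
    and degs: "\<And>X. X \<subseteq> V \<Longrightarrow> indep X \<Longrightarrow> card X = t \<Longrightarrow> (2 * k - 1) * t + 1 \<le> esum X V"
    and ex: "packing \<C>\<^sub>0" "card \<C>\<^sub>0 + 1 = k"
  shows "\<exists>\<D>. packing \<D> \<and> card \<D> = k"
proof (rule ccontr)
  assume no: "\<nexists>\<D>. packing \<D> \<and> card \<D> = k"
  define P where "P \<D> \<longleftrightarrow> packing \<D> \<and> card \<D> + 1 = k" for \<D>
  have "P \<C>\<^sub>0" using ex unfolding P_def by blast
  then obtain \<A> where A: "P \<A>" "\<And>\<D>. P \<D> \<Longrightarrow> card (\<Union>\<A>) \<le> card (\<Union>\<D>)"
    using ex_has_least_nat[of P \<C>\<^sub>0 "\<lambda>\<D>. card (\<Union>\<D>)"] by blast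
  define Q where "Q \<D> \<longleftrightarrow> P \<D> \<and> card (\<Union>\<D>) = card (\<Union>\<A>)" for \<D>
  define f where "f \<D> = esum (V - \<Union>\<D>) (V - \<Union>\<D>)" for \<D>
  have "f \<D> < Suc (esum V V)" for \<D>
  proof -
    have "f \<D> \<le> esum V V" unfolding f_def using finV by (intro esum_mono) auto
    then show ?thesis by simp
  qed
  then have bound: "\<forall>\<D>. Q \<D> \<longrightarrow> f \<D> < Suc (esum V V)" by blast
  have "Q \<A>" unfolding Q_def using A(1) by simp
  then have "\<exists>\<C>. Q \<C> \<and> (\<forall>\<D>. Q \<D> \<longrightarrow> f \<D> \<le> f \<C>)"
    using bound by (rule ex_has_greatest_nat[of Q \<A> f])
  then obtain \<C> where C: "Q \<C>" "\<And>\<D>. Q \<D> \<Longrightarrow> f \<D> \<le> f \<C>" by blast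
  have "cycle_packing V E k t \<C>"
  proof unfold_locales
    show "packing \<C>" "card \<C> + 1 = k" using C(1) unfolding Q_def P_def by auto
    have eq: "card (\<Union>\<C>) = card (\<Union>\<A>)" using C(1) unfolding Q_def by simp
    fix \<D> assume "packing \<D>"
    then show "card \<D> \<noteq> k" using no by blast
    assume "card \<D> + 1 = k"
    with \<open>packing \<D>\<close> have PD: "P \<D>" unfolding P_def by simp
    then show "card (\<Union>\<C>) \<le> card (\<Union>\<D>)" using A(2) eq by simp
    assume "card (\<Union>\<D>) = card (\<Union>\<C>)"
    then have "Q \<D>" unfolding Q_def using PD eq by simp
    then show "esum (V - \<Union>\<D>) (V - \<Union>\<D>) \<le> esum (V - \<Union>\<C>) (V - \<Union>\<C>)"
      using C(2) unfolding f_def by blast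
  next
    show "2 \<le> k" "5 \<le> t" "(2 * t - 1) * k \<le> card V" by (fact assms)+
    show "(2 * k - 1) * t + 1 \<le> esum X V" if "X \<subseteq> V" "indep X" "card X = t" for X
      by (rule degs[OF that])
  qed
  then show False by (rule cycle_packing.contradiction)
qed

text \<open>Both lower bounds weaken as k decreases, so the induction hypothesis supplies k - 1
  cycles to optimise. It starts from a single cycle: a forest would have t independent vertices of
  degree sum at most 2t < 3t + 1.\<close>

lemma packing_exists:
  assumes "2 \<le> k" "5 \<le> t" "(2 * t - 1) * k \<le> card V"
    and "\<And>X. X \<subseteq> V \<Longrightarrow> indep X \<Longrightarrow> card X = t \<Longrightarrow> (2 * k - 1) * t + 1 \<le> esum X V"
  shows "\<exists>\<D>. packing \<D> \<and> card \<D> = k"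
  using assms
proof (induction k rule: nat_induct_at_least)
  case base
  have "\<not> acyc V"
  proof
    assume ac: "acyc V"
    have "2 * t - 1 \<le> card V" using base.prems(2) by linarith
    then obtain X where X: "X \<subseteq> V" "indep X" "card X = t" "esum X V \<le> 2 * t"
      by (rule acyc_indep_small_degree[OF ac]) (use assms(2) in simp)
    then show False using base.prems(3)[OF X(1-3)] assms(2) by simp
  qed
  then obtain K where K: "core K" unfolding acyc_def by blast
  show ?case
  proof (rule packing_step)
    show "packing {K}" by (rule packing_single[OF K])
    show "(2 * 2 - 1) * t + 1 \<le> esum X V" if "X \<subseteq> V" "indep X" "card X = t" for X
      by (rule base.prems(3)[OF that])
  qed (use base.prems(1,2) in simp_all)
next
  case (Suc k)
  have "(2 * t - 1) * k \<le> card V" using Suc.prems(2) by simp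
  moreover have "(2 * k - 1) * t + 1 \<le> esum X V" if "X \<subseteq> V" "indep X" "card X = t" for X
  proof -
    have "(2 * k - 1) * t \<le> (2 * Suc k - 1) * t" by (intro mult_right_mono) auto
    then show ?thesis using Suc.prems(3)[OF that] by linarith
  qed
  ultimately obtain \<D> where D: "packing \<D>" "card \<D> = k" using Suc.IH[OF assms(2)] by blast
  show ?case
  proof (rule packing_step)
    show "packing \<D>" by (rule D(1))
    show "(2 * Suc k - 1) * t + 1 \<le> esum X V" if "X \<subseteq> V" "indep X" "card X = t" for X
      by (rule Suc.prems(3)[OF that])
  qed (use Suc.prems(1,2) Suc.hyps D(2) in simp_all)
qed

end

subsection \<open>Undirected cycles in digraphs\<close>

lemma graph_fin_graph:
  assumes "graph G"
  shows "fin_graph (verts G) (\<lambda>x y. x \<rightarrow>\<^bsub>G\<^esub> y)"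
proof -
  interpret graph G by (rule assms)
  show ?thesis
  proof
    show "finite (verts G)" by (rule finite_verts)
    show "y \<rightarrow>\<^bsub>G\<^esub> x" if "x \<rightarrow>\<^bsub>G\<^esub> y" for x y by (rule arcs_ends_symmetric[OF sym_arcs that])
    show "\<not> x \<rightarrow>\<^bsub>G\<^esub> x" for x using no_loops by (auto simp: arcs_ends_def arc_to_ends_def)
    show "x \<in> verts G" if "x \<rightarrow>\<^bsub>G\<^esub> y" for x y using that by (rule adj_in_verts)
  qed
qed

lemma out_degree_adjacent:
  assumes "graph G" "x \<in> verts G"
  shows "out_degree G x = card {y \<in> verts G. x \<rightarrow>\<^bsub>G\<^esub> y}"
proof -
  interpret graph G by (rule assms(1))
  have "inj_on (head G) (out_arcs G x)"
  proof (rule inj_onI)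
    fix a b assume ab: "a \<in> out_arcs G x" "b \<in> out_arcs G x" "head G a = head G b"
    then have "arc_to_ends G a = arc_to_ends G b" by (simp add: arc_to_ends_def)
    then show "a = b" using ab no_multi_arcs by auto
  qed
  moreover have "head G ` out_arcs G x = {y \<in> verts G. x \<rightarrow>\<^bsub>G\<^esub> y}"
    using head_in_verts by (auto simp: arcs_ends_def arc_to_ends_def image_iff)
  ultimately show ?thesis unfolding out_degree_def using card_image by metis
qed

lemma (in pre_digraph) cas_map_steps:
  assumes "\<And>i. i < n \<Longrightarrow> tail G (a i) = c i \<and> head G (a i) = c (Suc i)"
  shows "cas (c 0) (map a [0..<n]) (c n)"
  using assms
proof (induction n arbitrary: a c)
  case (Suc n)
  have "cas (c (Suc 0)) (map (\<lambda>i. a (Suc i)) [0..<n]) (c (Suc n))"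
    using Suc.IH[of "\<lambda>i. a (Suc i)" "\<lambda>i. c (Suc i)"] Suc.prems by simp
  moreover have "map a [0..<Suc n] = a 0 # map (\<lambda>i. a (Suc i)) [0..<n]"
    by (simp add: upt_conv_Cons map_Suc_upt[symmetric] del: upt_Suc)
  ultimately show ?case using Suc.prems[of 0] by simp
qed simp

text \<open>The arcs are read off one period of the sequence. Their heads are the n distinct
  vertices from index 1 to n, and n >= 3 excludes running back and forth along an edge.\<close>

lemma core_undirected_cycle:
  assumes "graph G" and "fin_graph.core (verts G) (\<lambda>x y. x \<rightarrow>\<^bsub>G\<^esub> y) K"
  shows "\<exists>p. undirected_cycle G p \<and> cycle_verts G p \<subseteq> K"
proof -
  interpret graph G by (rule assms(1))
  interpret F: fin_graph "verts G" "\<lambda>x y. x \<rightarrow>\<^bsub>G\<^esub> y" by (rule graph_fin_graph[OF assms(1)])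
  obtain c n where c: "F.cyc c n" "range c \<subseteq> K" by (rule F.core_cyc[OF assms(2)])
  have n3: "3 \<le> n" using c(1) unfolding F.cyc_def by (elim conjE)
  have "\<exists>e\<in>arcs G. tail G e = c (int i) \<and> head G e = c (int (Suc i))" for i
  proof -
    have "c (int i) \<rightarrow>\<^bsub>G\<^esub> c (int (Suc i))" by (rule F.cyc_edge[OF c(1)]) simp
    then show ?thesis by (auto simp: arcs_ends_def arc_to_ends_def)
  qed
  then have "\<forall>i. \<exists>e. e \<in> arcs G \<and> tail G e = c (int i) \<and> head G e = c (int (Suc i))" by blast
  then have "\<exists>a. \<forall>i. a i \<in> arcs G \<and> tail G (a i) = c (int i) \<and> head G (a i) = c (int (Suc i))"
    by (rule choice)
  then obtain a where a: "\<And>i. a i \<in> arcs G \<and> tail G (a i) = c (int i) \<and> head G (a i) = c (int (Suc i))"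
    by blast
  define p where "p = map a [0..<n]"
  have "c (int n) = c 0" using F.cyc_eq_iff[OF c(1), of "int n" 0] by simp
  have "cas (c (int 0)) p (c (int n))"
    unfolding p_def using a by (intro cas_map_steps[where c="\<lambda>i. c (int i)"]) auto
  then have "cas (c 0) p (c 0)" using \<open>c (int n) = c 0\<close> by simp
  moreover have "c 0 \<in> verts G" by (rule F.cyc_inV[OF c(1)])
  moreover have "set p \<subseteq> arcs G" unfolding p_def using a by auto
  ultimately have aw: "awalk (c 0) p (c 0)" unfolding awalk_def by blast
  have ne: "p \<noteq> []" unfolding p_def using n3 by auto
  have "tl (awalk_verts (c 0) p) = map (head G) p"
    using awalk_verts_conv'[of "c 0" p "c 0"] aw ne by (auto simp: awalk_def)
  also have "\<dots> = map (\<lambda>i. c (int (Suc i))) [0..<n]" unfolding p_def using a by simp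
  finally have tl: "tl (awalk_verts (c 0) p) = map (\<lambda>i. c (int (Suc i))) [0..<n]" .
  have "inj_on (\<lambda>i. c (int (Suc i))) {0..<n}"
  proof (rule inj_onI)
    fix i j assume ij: "i \<in> {0..<n}" "j \<in> {0..<n}" "c (int (Suc i)) = c (int (Suc j))"
    have "int (Suc i) = int (Suc j)" by (rule F.cyc_eq_near[OF c(1) ij(3)]) (use ij in auto)
    then show "i = j" by simp
  qed
  then have "distinct (tl (awalk_verts (c 0) p))" unfolding tl by (simp add: distinct_map)
  then have "cycle p" unfolding cycle_def using aw ne by blast
  then have "undirected_cycle G p" unfolding undirected_cycle_def using n3 by (simp add: p_def)
  moreover have "cycle_verts G p \<subseteq> K" unfolding cycle_verts_def p_def using a c(2) by auto
  ultimately show ?thesis by blast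
qed

theorem theorem5:
  fixes G :: "('a, 'b) pre_digraph" and k t :: nat
  assumes "graph G"
    and "k \<ge> 2" and "t \<ge> 5"
    and "card (verts G) \<ge> (2 * t - 1) * k"
    and "sigma t G \<ge> enat (2 * k * t - t + 1)"
  shows "\<exists>\<C>. finite \<C> \<and> card \<C> = k \<and> (\<forall>p\<in>\<C>. undirected_cycle G p) \<and>
    pairwise (\<lambda>p q. disjnt (cycle_verts G p) (cycle_verts G q)) \<C>"
proof -
  interpret F: fin_graph "verts G" "\<lambda>x y. x \<rightarrow>\<^bsub>G\<^esub> y" by (rule graph_fin_graph[OF assms(1)])
  have degs: "(2 * k - 1) * t + 1 \<le> F.esum X (verts G)"
    if X: "X \<subseteq> verts G" "F.indep X" "card X = t" for X
  proof -
    have "independent_set G X" using X(1,2) unfolding independent_set_def F.indep_def by blast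
    then have "sigma t G \<le> enat (\<Sum>x\<in>X. out_degree G x)"
      unfolding sigma_def using X(3) by (intro INF_lower) simp
    also have "(\<Sum>x\<in>X. out_degree G x) = F.esum X (verts G)"
      unfolding F.esum_def F.dg_def using X(1) out_degree_adjacent[OF assms(1)] by (intro sum.cong) auto
    finally have "enat (2 * k * t - t + 1) \<le> enat (F.esum X (verts G))" using assms(5) by (rule order_trans[rotated])
    then have "2 * k * t - t + 1 \<le> F.esum X (verts G)" by simp
    moreover have "(2 * k - 1) * t = 2 * k * t - t" by (simp add: diff_mult_distrib)
    ultimately show ?thesis by simp
  qed
  obtain \<D> where D: "F.packing \<D>" "card \<D> = k"
    using F.packing_exists[OF assms(2-4) degs] by blast
  have "\<forall>K\<in>\<D>. \<exists>p. undirected_cycle G p \<and> cycle_verts G p \<subseteq> K"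
    using core_undirected_cycle[OF assms(1)] F.packing_core[OF D(1)] by blast
  then obtain f where f: "\<forall>K\<in>\<D>. undirected_cycle G (f K) \<and> cycle_verts G (f K) \<subseteq> K" by (rule bchoice[THEN exE])
  \<comment> \<open>Disjoint nonempty vertex sets belong to different cycles, so the choice of
    cycles is injective and there are k of them.\<close>
  have ne: "cycle_verts G (f K) \<noteq> {}" if "K \<in> \<D>" for K
    using f that unfolding undirected_cycle_def cycle_verts_def by auto
  have disj: "cycle_verts G (f K) \<inter> cycle_verts G (f L) = {}" if "K \<in> \<D>" "L \<in> \<D>" "K \<noteq> L" for K L
  proof -
    have "K \<inter> L = {}" by (rule F.packing_disjoint[OF D(1) that])
    moreover have "cycle_verts G (f K) \<subseteq> K" "cycle_verts G (f L) \<subseteq> L" using f that by auto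
    ultimately show ?thesis by blast
  qed
  have "inj_on f \<D>"
  proof (rule inj_onI, rule ccontr)
    fix K L assume "K \<in> \<D>" "L \<in> \<D>" "f K = f L" "K \<noteq> L"
    then show False using disj[of K L] ne[of K] by simp
  qed
  then have "card (f ` \<D>) = k" using D(2) by (simp add: card_image)
  moreover have "finite (f ` \<D>)" using F.packing_finite[OF D(1)] by simp
  moreover have "\<forall>p\<in>f ` \<D>. undirected_cycle G p" using f by blast
  moreover have "pairwise (\<lambda>p q. disjnt (cycle_verts G p) (cycle_verts G q)) (f ` \<D>)"
    unfolding pairwise_def disjnt_def using disj by auto
  ultimately show ?thesis by blast
qed

end
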